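(* Let $n\ge 1$. Let $\mathcal Q$ be the set of all rationalizable tuples $q=(q_1,\dots,q_n)$ of nondecreasing left-continuous functions $q_i:[0,1]\to[0,1]$. Given essentially bounded functions $\psi_i^j$ on $[0,1]$ ($1\le i\le n$, $1\le j\le m$) and real numbers $\eta^1,\dots,\eta^m$, let $$\overline{\mathcal Q}:=\Big\{q\in\mathcal Q:\ \sum_{i=1}^n\int_0^1 q_i(x_i)\psi_i^j(x_i)\,dx_i\le\eta^j\ \ \forall j\in\{1,\dots,m\}\Big\}.$$ Then: (i) every extreme point of $\mathcal Q$ is rationalized by $\mathbf 1_A$ for some up-set $A\subseteq[0,1]^n$; (ii) every extreme point of $\overline{\mathcal Q}$ is rationalized by a mixture (convex combination) of $\{\mathbf 1_{A_j}\}_{j=1}^{m+1}$ for some nested up-sets $\{A_j\}_{j=1}^{m+1}$ of $[0,1]^n$.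
   Context: A tuple $q=(q_1,\dots,q_n)$ of nondecreasing left-continuous functions $[0,1]\to[0,1]$ is rationalized by a (measurable, not necessarily monotone) function $f:[0,1]^n\to[0,1]$ if $q_i(x_i)=\int_{[0,1]^{n-1}}f(x)\,dx_{-i}$ for all $i$ and all $x_i\in[0,1]$; $q$ is rationalizable if such an $f$ exists. Functions are viewed as elements of $L^1$, i.e. identified when equal almost everywhere (so in particular the value of $q_i$ at the point $0$ is immaterial and the rationalization identity is understood almost everywhere). A set $A\subseteq[0,1]^n$ is an up-set if $x\in A$, $y\ge x$ (component-wise) imply $y\in A$. Up-sets $\{A_j\}$ are nested if $A_j\subseteq A_{j'}$ for $j<j'$. *)

theory Defs
  imports "HOL-Analysis.Analysis"
begin

abbreviation unit_measure :: "real measure" where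
  "unit_measure \<equiv> lebesgue_on {0..1}"

text \<open>The points of \<open>[0,1]\<^sup>n\<close> are the functions \<open>'n \<Rightarrow> real\<close> with values in \<open>[0,1]\<close>, where the
  finite nonempty type \<open>'n\<close> indexes the coordinates, so \<open>n = CARD('n)\<close>. The order on this
  function type is the component-wise one.\<close>

definition unit_cube :: "('n::finite \<Rightarrow> real) set" where
  "unit_cube = {x. \<forall>i. x i \<in> {0..1}}"

definition up_set :: "('n::finite \<Rightarrow> real) set \<Rightarrow> bool" where
  "up_set A \<longleftrightarrow> A \<subseteq> unit_cube \<and> (\<forall>x\<in>A. \<forall>y\<in>unit_cube. x \<le> y \<longrightarrow> y \<in> A)"

text \<open>In the integral, \<open>y\<close> carries the coordinates other than \<open>i\<close>, so \<open>y(i := t)\<close> is the point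
  of the cube with \<open>i\<close>-th coordinate \<open>t\<close> and remaining coordinates \<open>y\<close>.\<close>

definition rationalizes :: "(('n::finite \<Rightarrow> real) \<Rightarrow> real) \<Rightarrow> ('n \<Rightarrow> real \<Rightarrow> real) \<Rightarrow> bool" where
  "rationalizes f q \<longleftrightarrow>
     f \<in> borel_measurable (\<Pi>\<^sub>M i\<in>UNIV. unit_measure) \<and>
     (\<forall>x\<in>unit_cube. f x \<in> {0..1}) \<and>
     (\<forall>i. AE t in unit_measure.
        q i t = (\<integral>y. f (y(i := t)) \<partial>(\<Pi>\<^sub>M k\<in>UNIV - {i}. unit_measure)))"

text \<open>Only the restriction of each \<open>q i\<close> to \<open>[0,1]\<close> matters, up to null sets.
  Left-continuity is vacuous at the left end point \<open>0\<close>.\<close>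

definition rationalizable_tuples :: "('n::finite \<Rightarrow> real \<Rightarrow> real) set" where
  "rationalizable_tuples =
     {q. (\<forall>i. mono_on {0..1} (q i) \<and>
              (\<forall>t\<in>{0<..1}. continuous (at_left t) (q i)) \<and>
              (\<forall>t\<in>{0..1}. q i t \<in> {0..1})) \<and>
         (\<exists>f. rationalizes f q)}"

definition ess_bounded :: "(real \<Rightarrow> real) \<Rightarrow> bool" where
  "ess_bounded g \<longleftrightarrow>
     g \<in> borel_measurable unit_measure \<and> (\<exists>C. AE t in unit_measure. \<bar>g t\<bar> \<le> C)"

definition constrained_tuples ::
    "nat \<Rightarrow> ('n::finite \<Rightarrow> nat \<Rightarrow> real \<Rightarrow> real) \<Rightarrow> (nat \<Rightarrow> real) \<Rightarrow> ('n \<Rightarrow> real \<Rightarrow> real) set" where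
  "constrained_tuples m \<psi> \<eta> =
     {q \<in> rationalizable_tuples.
        \<forall>j\<in>{1..m}. (\<Sum>i\<in>UNIV. \<integral>t. q i t * \<psi> i j t \<partial>unit_measure) \<le> \<eta> j}"

definition ae_eq :: "('n::finite \<Rightarrow> real \<Rightarrow> real) \<Rightarrow> ('n \<Rightarrow> real \<Rightarrow> real) \<Rightarrow> bool" where
  "ae_eq p q \<longleftrightarrow> (\<forall>i. AE t in unit_measure. p i t = q i t)"

text \<open>This is \<^const>\<open>extreme_point_of\<close> (with \<^const>\<open>open_segment\<close> unfolded) in the space of
  tuples of elements of \<open>L\<^sup>1\<close>, written in terms of representatives: equality there is
  almost-everywhere equality of each component.\<close>

definition ae_extreme_point_of ::
    "('n::finite \<Rightarrow> real \<Rightarrow> real) \<Rightarrow> ('n \<Rightarrow> real \<Rightarrow> real) set \<Rightarrow> bool"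
    (infixr "ae'_extreme'_point'_of" 50) where
  "q ae_extreme_point_of S \<longleftrightarrow>
     q \<in> S \<and>
     (\<forall>a\<in>S. \<forall>b\<in>S. \<not> (\<not> ae_eq a b \<and>
        (\<exists>u. 0 < u \<and> u < 1 \<and> ae_eq q (\<lambda>i t. (1 - u) * a i t + u * b i t))))"

end

theory Submission imports Defs begin

text \<open>By a swapping argument for the least-squares rationalization, every rationalizable tuple \<open>q\<close> of
  nondecreasing functions is rationalized by a monotone \<open>f\<close>.  If \<open>g\<close> is Lipschitz with
  \<open>g 0 = g 1 = 0\<close>, then \<open>f \<plusminus> \<epsilon> g(f)\<close> is again monotone and \<open>[0,1]\<close>-valued for small \<open>\<epsilon>\<close>; hence, if
  \<open>q\<close> is extreme and \<open>g(f)\<close> does not change the \<open>m\<close> constraint values, then \<open>g(f)\<close> has zero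
  marginals.  Now \<open>f\<close> is the average of the truncations of \<open>N f - k\<close>, \<open>k < N\<close>, to \<open>[0,1]\<close>.
  Caratheodory's theorem replaces this average by a mixture of \<open>m + 1\<close> of them with the same
  constraint values, which therefore still rationalizes \<open>q\<close>.  As \<open>N \<rightarrow> \<infinity>\<close>, a subsequence
  converges to a finite mixture of level sets of \<open>f\<close>, and a second application of the same argument
  to this mixture leaves \<open>m + 1\<close> nested up-sets.  Part (i) is the case \<open>m = 0\<close>.\<close>

section \<open>Finite combinations and minimizing sequences\<close>

text \<open>The swap needs finitely many cells, so \<open>q\<close> is matched only through
  integrals over dyadic slabs. In the passage to finer grids, the monotone functions that match
  level \<open>N\<close> form decreasing convex sets, and almost norm-minimal members converge by
  the parallelogram law. The integrals that survive determine \<open>q\<close> on (0,1], because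
  \<open>q\<close> is left-continuous. Monotonicity of \<open>f\<close> matters because a monotone
  perturbation has nondecreasing marginals again and so gives a competitor in the constrained set.
  The layer-cake formula writes \<open>f\<close> as a mixture of its level sets, but that mixture is
  a continuum, and subtracting a multiple of an indicator can destroy monotonicity. Lipschitz ramps
  avoid both problems. The price is paid in the limit, where a ramp may take any value in [0,1] on
  {f = s}: each limit is a mixture of {f \<ge> s} and {f > s}, so up to 2(m + 1) sets appear. In the
  second reduction, strict positivity of the weights replaces the Lipschitz bound. The number
  \<open>m + 1\<close> counts the \<open>m\<close> constraint values and the total weight.\<close>

lemma nontrivial_kernel:
  fixes a :: "'j \<Rightarrow> 'k \<Rightarrow> real"
  assumes "finite J" "finite K" "card J < card K"
  shows "\<exists>c. (\<exists>k\<in>K. c k \<noteq> 0) \<and> (\<forall>j\<in>J. (\<Sum>k\<in>K. a j k * c k) = 0)"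
  using assms
proof (induction J arbitrary: K a rule: finite_induct)
  case empty
  then obtain k where "k \<in> K" by fastforce
  then show ?case by (intro exI[of _ "\<lambda>_. 1"]) auto
next
  case (insert i J)
  show ?case
  proof (cases "\<forall>k\<in>K. a i k = 0")
    case True
    obtain c where "\<exists>k\<in>K. c k \<noteq> 0" "\<forall>j\<in>J. (\<Sum>k\<in>K. a j k * c k) = 0"
      using insert.IH[of K a] insert.prems insert.hyps by auto
    then show ?thesis using True by (intro exI[of _ c]) auto
  next
    case False
    then obtain p where p: "p \<in> K" "a i p \<noteq> 0" by blast
    \<comment> \<open>Gaussian elimination: row \<open>j\<close> minus the multiple of row
      \<open>i\<close> that clears the pivot column \<open>p\<close>. Below, \<open>d\<close> is the
      value of the unknown \<open>p\<close> obtained by back substitution in row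
      \<open>i\<close>.\<close>
    define b where "b j k = a j k - a j p * a i k / a i p" for j k
    have "card J < card (K - {p})"
      using insert p by auto
    then obtain c where c: "\<exists>k\<in>K - {p}. c k \<noteq> 0" "\<forall>j\<in>J. (\<Sum>k\<in>K - {p}. b j k * c k) = 0"
      using insert.IH[of "K - {p}" b] insert.prems by auto
    define d where "d = - (\<Sum>k\<in>K - {p}. a i k * c k) / a i p"
    have sum_eq: "(\<Sum>k\<in>K. a j k * (c(p := d)) k) = a j p * d + (\<Sum>k\<in>K - {p}. a j k * c k)" for j
      using p insert.prems by (subst sum.remove[of _ p]) (auto intro!: sum.cong)
    have "(\<Sum>k\<in>K. a i k * (c(p := d)) k) = 0"
      using p by (subst sum_eq) (simp add: d_def)
    moreover have "(\<Sum>k\<in>K. a j k * (c(p := d)) k) = 0" if "j \<in> J" for j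
    proof -
      have "(\<Sum>k\<in>K - {p}. b j k * c k)
          = (\<Sum>k\<in>K - {p}. a j k * c k) - a j p / a i p * (\<Sum>k\<in>K - {p}. a i k * c k)"
        unfolding b_def sum_distrib_left sum_subtractf[symmetric]
        by (intro sum.cong) (auto simp: field_simps)
      then show ?thesis
        using c that by (subst sum_eq) (simp add: d_def)
    qed
    ultimately show ?thesis
      using c by (intro exI[of _ "c(p := d)"]) auto
  qed
qed

lemma caratheodory_finite:
  fixes w :: "'k \<Rightarrow> real" and v :: "nat \<Rightarrow> 'k \<Rightarrow> real"
  assumes "finite K" "\<And>k. k \<in> K \<Longrightarrow> 0 \<le> w k" "sum w K = 1"
  shows "\<exists>S w'. S \<subseteq> K \<and> card S \<le> m + 1 \<and> (\<forall>k\<in>S. 0 \<le> w' k) \<and> sum w' S = 1 \<and>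
           (\<forall>j\<in>{1..m}. (\<Sum>k\<in>S. w' k * v j k) = (\<Sum>k\<in>K. w k * v j k))"
  using assms
proof (induction K arbitrary: w rule: finite_psubset_induct)
  case (psubset K)
  show ?case
  proof (cases "card K \<le> m + 1")
    case True
    then show ?thesis using psubset.prems by (intro exI[of _ K] exI[of _ w]) auto
  next
    case False
    \<comment> \<open>The sums are numbered from 1, so row 0 is free for the constant row 1, whose
      equation says that \<open>c\<close> preserves the total weight.\<close>
    have "card {0..m} < card K" using False by simp
    then obtain c where c: "\<exists>k\<in>K. c k \<noteq> 0"
      "\<forall>j\<in>{0..m}. (\<Sum>k\<in>K. (if j = 0 then 1 else v j k) * c k) = 0"
      using nontrivial_kernel[OF _ psubset.hyps, of "{0..m}" "\<lambda>j k. if j = 0 then 1 else v j k"]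
      by auto
    have c0: "sum c K = 0" using c(2)[rule_format, of 0] by simp
    have cv: "(\<Sum>k\<in>K. v j k * c k) = 0" if "j \<in> {1..m}" for j
      using c(2)[rule_format, of j] that by simp
    have "\<exists>k\<in>K. c k > 0"
    proof (rule ccontr)
      assume "\<not> ?thesis"
      then have "\<forall>k\<in>K. - c k \<ge> 0" by force
      then have "\<forall>k\<in>K. - c k = 0"
        using sum_nonneg_eq_0_iff[of K "\<lambda>k. - c k"] psubset.hyps c0 by (simp add: sum_negf)
      then show False using c(1) by auto
    qed
    then have ne: "{k\<in>K. c k > 0} \<noteq> {}" and fin: "finite {k\<in>K. c k > 0}"
      using psubset.hyps by auto
    \<comment> \<open>The ratio test: \<open>t\<close> is the largest step for which all weights
      \<open>w k - t * c k\<close> stay nonnegative, and an index \<open>p\<close> attaining the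
      minimum gets weight 0.\<close>
    define t where "t = Min ((\<lambda>k. w k / c k) ` {k\<in>K. c k > 0})"
    have "t \<in> (\<lambda>k. w k / c k) ` {k\<in>K. c k > 0}"
      unfolding t_def using ne fin by (intro Min_in) auto
    then obtain p where p: "p \<in> K" "c p > 0" "t = w p / c p" by auto
    have t_le: "t \<le> w k / c k" if "k \<in> K" "c k > 0" for k
      unfolding t_def using that fin by (intro Min_le) auto
    have t0: "t \<ge> 0" using p psubset.prems by simp
    define u where "u k = w k - t * c k" for k
    have u0: "u k \<ge> 0" if "k \<in> K" for k
    proof (cases "c k > 0")
      case True
      then show ?thesis using t_le[OF that] by (simp add: u_def field_simps)
    next
      case False
      then have "t * c k \<le> 0" using t0 by (simp add: mult_nonneg_nonpos)
      then show ?thesis using psubset.prems(1)[OF that] by (simp add: u_def)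
    qed
    have up: "u p = 0" using p by (simp add: u_def)
    have rm: "(\<Sum>k\<in>K - {p}. u k * g k) = (\<Sum>k\<in>K. w k * g k) - t * (\<Sum>k\<in>K. g k * c k)" for g
    proof -
      have "(\<Sum>k\<in>K. u k * g k) = (\<Sum>k\<in>K - {p}. u k * g k)"
        using p up psubset.hyps by (simp add: sum.remove)
      moreover have "(\<Sum>k\<in>K. u k * g k) = (\<Sum>k\<in>K. w k * g k) - t * (\<Sum>k\<in>K. g k * c k)"
        unfolding u_def sum_distrib_left sum_subtractf[symmetric]
        by (intro sum.cong) (auto simp: algebra_simps)
      ultimately show ?thesis by simp
    qed
    have "sum u (K - {p}) = 1"
      using rm[of "\<lambda>_. 1"] c0 psubset.prems by simp
    then obtain S w' where "S \<subseteq> K - {p}" "card S \<le> m + 1" "\<forall>k\<in>S. 0 \<le> w' k" "sum w' S = 1"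
        "\<forall>j\<in>{1..m}. (\<Sum>k\<in>S. w' k * v j k) = (\<Sum>k\<in>K - {p}. u k * v j k)"
      using psubset.IH[of "K - {p}" u] p u0 by blast
    then show ?thesis
      using rm cv by (intro exI[of _ S] exI[of _ w']) auto
  qed
qed

section \<open>Listing the elements of a finite chain\<close>

lemma finite_total_preorder_has_max:
  assumes "finite S" "S \<noteq> {}" "\<And>x y. x \<in> S \<Longrightarrow> y \<in> S \<Longrightarrow> R x y \<or> R y x"
    and "\<And>x y z. R x y \<Longrightarrow> R y z \<Longrightarrow> R x z"
  shows "\<exists>b\<in>S. \<forall>x\<in>S. R x b"
  using assms(1,2,3)
proof (induction S rule: finite_ne_induct)
  case (insert a S)
  then obtain b where b: "b \<in> S" "\<forall>x\<in>S. R x b" by auto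
  have aa: "R a a" using insert.prems[of a a] by simp
  show ?case
  proof (cases "R a b")
    case True
    then show ?thesis using b by auto
  next
    case False
    then have "R b a" using insert.prems[of a b] b by auto
    then have "\<forall>x\<in>insert a S. R x a" using b aa assms(4)[of _ b a] by auto
    then show ?thesis by auto
  qed
qed auto

text \<open>The target is a list of exactly \<open>m + 1\<close> entries, while \<open>S\<close> may
  be smaller; surplus positions repeat an element with weight 0. \<open>R\<close> is a preorder
  because different indices may carry the same set. Quantifying over all \<open>F\<close> lets one
  list serve for pointwise values, constraint values and the total weight.\<close>

lemma enumerate_total_preorder:
  fixes w :: "'k \<Rightarrow> real"
  assumes "finite S" "S \<noteq> {}" "card S \<le> m + 1" "\<And>k. k \<in> S \<Longrightarrow> 0 \<le> w k"
    and "\<And>x y. x \<in> S \<Longrightarrow> y \<in> S \<Longrightarrow> R x y \<or> R y x"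
    and "\<And>x y z. R x y \<Longrightarrow> R y z \<Longrightarrow> R x z"
  shows "\<exists>\<kappa> \<omega>. (\<forall>j\<in>{1..m + 1}. \<kappa> j \<in> S \<and> 0 \<le> \<omega> j) \<and>
           (\<forall>j\<in>{1..m + 1}. \<forall>j'\<in>{1..m + 1}. j < j' \<longrightarrow> R (\<kappa> j) (\<kappa> j')) \<and>
           (\<forall>F :: 'k \<Rightarrow> real. (\<Sum>j = 1..m + 1. \<omega> j * F (\<kappa> j)) = (\<Sum>k\<in>S. w k * F k))"
  using assms(1-5)
proof (induction m arbitrary: S)
  case (0 S)
  then have "card S = 1" by (simp add: card_gt_0_iff le_antisym Suc_leI)
  then obtain b where "S = {b}" by (auto simp: card_1_singleton_iff)
  then show ?case
    using 0 by (intro exI[of _ "\<lambda>_. b"] exI[of _ "\<lambda>_. w b"]) auto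
next
  case (Suc m S)
  obtain b where b: "b \<in> S" "\<forall>x\<in>S. R x b"
    using finite_total_preorder_has_max[of S R] Suc.prems assms(6) by blast
  show ?case
  proof (cases "S = {b}")
    case True
    \<comment> \<open>With a single element left, position 1 takes all of its weight and the other
      positions are padding.\<close>
    have "(\<Sum>j = 1..Suc m + 1. (if j = 1 then w b else 0) * F b) = w b * F b" for F :: "'k \<Rightarrow> real"
      by (subst sum.remove[of _ 1]) auto
    then show ?thesis
      using True Suc.prems by (intro exI[of _ "\<lambda>_. b"] exI[of _ "\<lambda>j. if j = 1 then w b else 0"]) auto
  next
    case False
    then have "S - {b} \<noteq> {}" "card (S - {b}) \<le> m + 1" using b Suc.prems by auto
    then obtain \<kappa> \<omega> where *: "\<forall>j\<in>{1..m + 1}. \<kappa> j \<in> S - {b} \<and> 0 \<le> \<omega> j"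
      "\<forall>j\<in>{1..m + 1}. \<forall>j'\<in>{1..m + 1}. j < j' \<longrightarrow> R (\<kappa> j) (\<kappa> j')"
      "\<And>F :: 'k \<Rightarrow> real. (\<Sum>j = 1..m + 1. \<omega> j * F (\<kappa> j)) = (\<Sum>k\<in>S - {b}. w k * F k)"
      using Suc.IH[of "S - {b}"] Suc.prems by auto
    \<comment> \<open>The maximum \<open>b\<close> goes to the last position, which is
      \<open>Suc m + 1 = m + 2\<close>.\<close>
    let ?\<kappa> = "\<lambda>j. if j = m + 2 then b else \<kappa> j"
    let ?\<omega> = "\<lambda>j. if j = m + 2 then w b else \<omega> j"
    have "(\<Sum>j = 1..Suc m + 1. ?\<omega> j * F (?\<kappa> j)) = (\<Sum>k\<in>S. w k * F k)" for F :: "'k \<Rightarrow> real"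
    proof -
      have "(\<Sum>j = 1..Suc m + 1. ?\<omega> j * F (?\<kappa> j)) = (\<Sum>j = 1..m + 1. ?\<omega> j * F (?\<kappa> j)) + w b * F b"
        by simp
      also have "(\<Sum>j = 1..m + 1. ?\<omega> j * F (?\<kappa> j)) = (\<Sum>j = 1..m + 1. \<omega> j * F (\<kappa> j))"
        by (intro sum.cong) auto
      finally show ?thesis using *(3)[of F] b Suc.prems(1) by (simp add: sum.remove)
    qed
    moreover have "\<forall>j\<in>{1..Suc m + 1}. ?\<kappa> j \<in> S \<and> 0 \<le> ?\<omega> j"
      using * b Suc.prems by (auto simp: le_Suc_eq)
    moreover have "\<forall>j\<in>{1..Suc m + 1}. \<forall>j'\<in>{1..Suc m + 1}. j < j' \<longrightarrow> R (?\<kappa> j) (?\<kappa> j')"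
      using * b by (auto simp: le_Suc_eq)
    ultimately show ?thesis
      by (intro exI[of _ ?\<kappa>] exI[of _ ?\<omega>] conjI allI) assumption+
  qed
qed

section \<open>Convergence of minimizing sequences\<close>

lemma common_convergent_subseq:
  fixes X :: "'j \<Rightarrow> nat \<Rightarrow> real"
  assumes "finite J" "\<And>j n. j \<in> J \<Longrightarrow> X j n \<in> {0..1}"
  shows "\<exists>r l. strict_mono r \<and> (\<forall>j\<in>J. l j \<in> {0..1} \<and> (\<lambda>n. X j (r n)) \<longlonglongrightarrow> l j)"
  using assms
proof (induction J rule: finite_induct)
  case empty
  show ?case by (intro exI[of _ id]) (simp add: strict_mono_def)
next
  case (insert i J)
  then obtain r l where r: "strict_mono r" "\<forall>j\<in>J. l j \<in> {0..1} \<and> (\<lambda>n. X j (r n)) \<longlonglongrightarrow> l j"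
    by auto
  have "\<forall>n. X i (r n) \<in> {0..1}" using insert.prems by simp
  then obtain x s where s: "x \<in> {0..1}" "strict_mono s" "((\<lambda>n. X i (r n)) \<circ> s) \<longlonglongrightarrow> x"
    using seq_compactE[OF compact_imp_seq_compact[OF compact_Icc[of 0 "1::real"]], of "\<lambda>n. X i (r n)"]
    by metis
  have "(\<lambda>n. X j (r (s n))) \<longlonglongrightarrow> l j" if "j \<in> J" for j
    using LIMSEQ_subseq_LIMSEQ[OF _ s(2), of "\<lambda>n. X j (r n)"] r that by (auto simp: o_def)
  then show ?case
    using r s insert.hyps strict_mono_o[OF r(1) s(2)]
    by (intro exI[of _ "r \<circ> s"] exI[of _ "l(i := x)"]) (auto simp: o_def)
qed

text \<open>The members \<open>F N\<close> almost minimize the L2 norm over \<open>K N\<close>. The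
  infima \<open>a N\<close> increase and are bounded, hence form a Cauchy sequence, and the
  parallelogram law turns this into the Cauchy property of \<open>F\<close> in L2, then in L1, so
  that a subsequence converges almost everywhere. The infimum need not be attained, hence the slack
  \<open>\<epsilon> N\<close>.\<close>

lemma (in finite_measure) convex_chain_AE_convergent:
  fixes K :: "nat \<Rightarrow> ('a \<Rightarrow> real) set"
  assumes dec: "\<And>N N'. N \<le> N' \<Longrightarrow> K N' \<subseteq> K N" and ne: "\<And>N. K N \<noteq> {}"
    and meas: "\<And>N f. f \<in> K N \<Longrightarrow> f \<in> borel_measurable M"
    and range: "\<And>N f x. f \<in> K N \<Longrightarrow> x \<in> space M \<Longrightarrow> f x \<in> {0..1}"
    and mid: "\<And>N f g. f \<in> K N \<Longrightarrow> g \<in> K N \<Longrightarrow> (\<lambda>x. (f x + g x) / 2) \<in> K N"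
  shows "\<exists>F. (\<forall>N. F N \<in> K N) \<and> (AE x in M. convergent (\<lambda>N. F N x))"
proof -
  define E where "E f = (\<integral>x. (f x)\<^sup>2 \<partial>M)" for f :: "'a \<Rightarrow> real"
  have intb: "integrable M g" if "g \<in> borel_measurable M" "\<And>x. x \<in> space M \<Longrightarrow> g x \<in> {-1..1}" for g :: "'a \<Rightarrow> real"
  proof (rule integrable_const_bound[where B = 1])
    show "AE x in M. norm (g x) \<le> 1" using that(2) by (intro AE_I2) (force simp: abs_le_iff)
  qed (rule that(1))
  have sq_int: "integrable M (\<lambda>x. (f x)\<^sup>2)" if "f \<in> K N" for f N
    using meas[OF that] range[OF that]
    by (intro intb) (auto intro: power_le_one order_trans[OF _ zero_le_power2])
  have E0: "E f \<ge> 0" for f unfolding E_def by simp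
  have E_le: "E f \<le> measure M (space M)" if "f \<in> K N" for f N
  proof -
    have "E f \<le> (\<integral>x. 1 \<partial>M)"
      unfolding E_def using sq_int[OF that] range[OF that]
      by (intro integral_mono) (auto intro: power_le_one)
    then show ?thesis by simp
  qed
  define a where "a N = Inf (E ` K N)" for N
  have bdd: "bdd_below (E ` K N)" for N using E0 by (intro bdd_belowI2[of _ 0])
  have a_le: "a N \<le> E f" if "f \<in> K N" for f N
    unfolding a_def using bdd that by (intro cInf_lower) auto
  have a_mono: "a N \<le> a N'" if "N \<le> N'" for N N'
    unfolding a_def using dec[OF that] ne bdd by (intro cInf_superset_mono) auto
  have "a N \<le> measure M (space M)" for N
    using a_le E_le ne by (meson all_not_in_conv order_trans)
  moreover have "incseq a" using a_mono by (auto simp: incseq_def)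
  ultimately have "convergent a"
    by (metis incseq_convergent convergentI)
  then have Ca: "Cauchy a" by (simp add: Cauchy_convergent_iff)
  define \<epsilon> where "\<epsilon> N = 1 / real (Suc N)" for N
  have \<epsilon>_anti: "\<epsilon> N' \<le> \<epsilon> N" if "N \<le> N'" for N N'
    unfolding \<epsilon>_def using that by (intro frac_le) auto
  have "\<exists>f\<in>K N. E f < a N + \<epsilon> N" for N
    using cInf_lessD[of "E ` K N" "a N + \<epsilon> N"] ne unfolding a_def[symmetric]
    by (auto simp: \<epsilon>_def)
  then obtain F where F: "\<And>N. F N \<in> K N" "\<And>N. E (F N) < a N + \<epsilon> N"
    by metis
  have diff: "\<bar>F i x - F j x\<bar> \<le> 1" if "x \<in> space M" for i j x
    using range[OF F(1)[of i] that] range[OF F(1)[of j] that] by (auto simp: abs_le_iff)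
  have diff_int: "integrable M (\<lambda>x. (F i x - F j x)\<^sup>2)" for i j
    using meas[OF F(1)] diff
    by (intro intb) (auto intro: order_trans[OF _ zero_le_power2] simp: abs_square_le_1)
  \<comment> \<open>For \<open>i \<le> j\<close> both functions lie in \<open>K i\<close>, and so
    does their midpoint; its squared norm is therefore at least \<open>a i\<close>, which bounds the
    remaining term of the parallelogram law.\<close>
  have est: "(\<integral>x. (F i x - F j x)\<^sup>2 \<partial>M) \<le> 2 * (a j - a i) + 4 * \<epsilon> i" if "i \<le> j" for i j
  proof -
    have Fj: "F j \<in> K i" using F dec[OF that] by auto
    have "a i \<le> E (\<lambda>x. (F i x + F j x) / 2)"
      using mid[OF F(1) Fj] by (rule a_le)
    also have "\<dots> = (\<integral>x. (F i x)\<^sup>2 / 2 + (F j x)\<^sup>2 / 2 - (F i x - F j x)\<^sup>2 / 4 \<partial>M)"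
      unfolding E_def by (intro Bochner_Integration.integral_cong) (auto simp: power2_eq_square field_simps)
    also have "\<dots> = E (F i) / 2 + E (F j) / 2 - (\<integral>x. (F i x - F j x)\<^sup>2 \<partial>M) / 4"
      unfolding E_def using sq_int[OF F(1)] diff_int[of i j] by simp
    finally have "(\<integral>x. (F i x - F j x)\<^sup>2 \<partial>M) \<le> 2 * E (F i) + 2 * E (F j) - 4 * a i" by simp
    also have "\<dots> \<le> 2 * (a j - a i) + 4 * \<epsilon> i"
      using F(2)[of i] F(2)[of j] \<epsilon>_anti[OF that] by argo
    finally show ?thesis .
  qed
  have sq_small: "\<exists>N. \<forall>i\<ge>N. \<forall>j\<ge>N. (\<integral>x. (F i x - F j x)\<^sup>2 \<partial>M) < e" if "e > 0" for e
  proof -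
    obtain N1 where N1: "\<And>i j. i \<ge> N1 \<Longrightarrow> j \<ge> N1 \<Longrightarrow> \<bar>a i - a j\<bar> < e / 8"
      using Ca \<open>e > 0\<close> unfolding Cauchy_def dist_real_def by (metis divide_pos_pos zero_less_numeral)
    obtain N2 :: nat where N2: "8 / e < N2" using reals_Archimedean2 by blast
    have *: "(\<integral>x. (F i x - F j x)\<^sup>2 \<partial>M) < e" if "i \<ge> max N1 N2" "j \<ge> i" for i j
    proof -
      have "real (Suc i) > 8 / e" using N2 that by linarith
      then have "4 * \<epsilon> i < e / 2" unfolding \<epsilon>_def using \<open>e > 0\<close> by (simp add: field_simps)
      moreover have "a j - a i < e / 8" 
        using that by (intro le_less_trans[OF abs_ge_self N1[of j i]]) auto
      ultimately show ?thesis using est[OF that(2)] \<open>e > 0\<close> by argo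
    qed
    show ?thesis
    proof (intro exI[of _ "max N1 N2"] allI impI)
      fix i j assume ij: "i \<ge> max N1 N2" "j \<ge> max N1 N2"
      show "(\<integral>x. (F i x - F j x)\<^sup>2 \<partial>M) < e"
        using *[of i j] *[of j i] ij by (cases "i \<le> j") (auto simp: power2_commute)
    qed
  qed
  have "\<exists>N. \<forall>i\<ge>N. \<forall>j\<ge>N. (\<integral>x. norm (F i x - F j x) \<partial>M) < e" if e0: "e > 0" for e
  proof -
    \<comment> \<open>Chosen for the bound |d| \<le> d^2 / (2 \<delta>) + \<delta> / 2 used below:
      integrating it gives two terms, each below \<open>e / 2\<close>. Adding 1 to the total mass
      covers the case of mass 0.\<close>
    define \<delta> where "\<delta> = e / (2 * (measure M (space M) + 1))"
    have pos: "measure M (space M) + 1 > 0" by (rule add_nonneg_pos) simp_all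
    then have \<delta>0: "\<delta> > 0" unfolding \<delta>_def using that by simp
    have "\<delta> * measure M (space M) \<le> \<delta> * (measure M (space M) + 1)" using \<delta>0 by simp
    also have "\<dots> = e / 2" unfolding \<delta>_def using pos by (simp add: field_simps)
    also have "\<dots> < e" using that by simp
    finally have \<delta>: "\<delta> > 0" "\<delta> * measure M (space M) < e" using \<delta>0 by auto
    obtain N where N: "\<And>i j. i \<ge> N \<Longrightarrow> j \<ge> N \<Longrightarrow> (\<integral>x. (F i x - F j x)\<^sup>2 \<partial>M) < \<delta> * e"
      using sq_small[OF mult_pos_pos[OF \<delta>(1) e0]] by blast
    have "(\<integral>x. norm (F i x - F j x) \<partial>M) < e" if ij: "i \<ge> N" "j \<ge> N" for i j
    proof -
      have am_gm: "\<bar>d\<bar> \<le> d\<^sup>2 / (2 * \<delta>) + \<delta> / 2" for d :: real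
      proof -
        have "0 \<le> (\<bar>d\<bar> - \<delta>)\<^sup>2" by simp
        also have "\<dots> = d\<^sup>2 - 2 * \<delta> * \<bar>d\<bar> + \<delta>\<^sup>2" by (simp add: power2_diff)
        finally show ?thesis using \<delta>(1) by (simp add: field_simps power2_eq_square)
      qed
      have "integrable M (\<lambda>x. norm (F i x - F j x))"
        using meas[OF F(1)] diff by (intro intb) (auto intro: order_trans[OF _ abs_ge_zero])
      then have "(\<integral>x. norm (F i x - F j x) \<partial>M) \<le> (\<integral>x. (F i x - F j x)\<^sup>2 / (2 * \<delta>) + \<delta> / 2 \<partial>M)"
        using diff_int[of i j] am_gm by (intro integral_mono) auto
      also have "\<dots> = (\<integral>x. (F i x - F j x)\<^sup>2 \<partial>M) / (2 * \<delta>) + \<delta> * measure M (space M) / 2"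
        using diff_int[of i j] by simp
      also have "\<dots> < \<delta> * e / (2 * \<delta>) + e / 2"
        using N[OF ij] \<delta> by (intro add_strict_mono divide_strict_right_mono) auto
      also have "\<dots> = e" using \<delta> by simp
      finally show ?thesis .
    qed
    then show ?thesis by blast
  qed
  moreover have "integrable M (F n)" for n
  proof (rule intb[OF meas[OF F(1)]])
    show "F n x \<in> {-1..1}" if "x \<in> space M" for x
      using range[OF F(1)[of n] that] by auto
  qed
  ultimately obtain r where r: "strict_mono r" "AE x in M. Cauchy (\<lambda>i. F (r i) x)"
    using cauchy_L1_AE_cauchy_subseq[of M F] by metis
  \<comment> \<open>A strictly increasing \<open>r\<close> satisfies \<open>N \<le> r N\<close>, and
    the sets decrease, so the subsequence still has its \<open>N\<close>-th member in
    \<open>K N\<close>.\<close>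
  have "F (r N) \<in> K N" for N
    using F(1)[of "r N"] dec[OF seq_suble[OF r(1)]] by auto
  moreover have "AE x in M. convergent (\<lambda>N. F (r N) x)"
    using r(2) by (auto simp: Cauchy_convergent_iff)
  ultimately show ?thesis by (intro exI[of _ "\<lambda>N. F (r N)"]) auto
qed

section \<open>Monotone rearrangement on a finite grid\<close>

definition grid :: "nat \<Rightarrow> ('n::finite \<Rightarrow> nat) set" where
  "grid M = {a. \<forall>i. a i < M}"

lemma finite_grid: "finite (grid M :: ('n::finite \<Rightarrow> nat) set)"
proof -
  have "grid M = (PiE UNIV (\<lambda>_. {..<M}) :: ('n \<Rightarrow> nat) set)"
    by (auto simp: grid_def PiE_UNIV_domain)
  then show ?thesis by (auto intro: finite_PiE)
qed

text \<open>The coordinates of \<open>a\<close> are replaced by those of \<open>b\<close> one at a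
  time; each intermediate point is in the grid and each replacement is a step covered by the
  assumption.\<close>

lemma grid_mono_if_coordinatewise:
  fixes B :: "('n::finite \<Rightarrow> nat) \<Rightarrow> real"
  assumes step: "\<And>a i k. a \<in> grid M \<Longrightarrow> a i < k \<Longrightarrow> k < M \<Longrightarrow> B a \<le> B (a(i := k))"
    and ab: "a \<in> grid M" "b \<in> grid M" "a \<le> b"
  shows "B a \<le> B b"
proof -
  have "B a \<le> B (\<lambda>j. if j \<in> I then b j else a j)" if "finite I" for I
    using that
  proof (induction I rule: finite_induct)
    case (insert i I)
    let ?c = "\<lambda>j. if j \<in> I then b j else a j"
    have eq: "(\<lambda>j. if j \<in> insert i I then b j else a j) = ?c(i := b i)" by auto
    have c: "?c \<in> grid M" using ab by (auto simp: grid_def)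
    have ci: "?c i = a i" using insert.hyps by simp
    have "B ?c \<le> B (?c(i := b i))"
    proof (cases "a i < b i")
      case True
      then show ?thesis using step[OF c, of i "b i"] ci ab by (auto simp: grid_def)
    next
      case False
      then have "b i = a i" using ci le_funD[OF ab(3), of i] by simp
      then have "?c(i := b i) = ?c" using insert.hyps by (auto simp: fun_eq_iff)
      then show ?thesis by simp
    qed
    then show ?case using insert.IH unfolding eq by linarith
  qed simp
  from this[of UNIV] show ?thesis by simp
qed

text \<open>Compactness of a finite power of [0,1]: the slab constraints and the sum of squares are
  continuous, and \<open>A\<close> itself is feasible.\<close>

lemma grid_least_squares:
  fixes A :: "('n::finite \<Rightarrow> nat) \<Rightarrow> real"
  assumes "\<And>a. a \<in> grid M \<Longrightarrow> A a \<in> {0..1}"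
  defines "feas \<equiv> {B. (\<forall>a\<in>grid M. B a \<in> {0..1}) \<and>
     (\<forall>i. \<forall>k<M. (\<Sum>a\<in>{a\<in>grid M. a i = k}. B a) = (\<Sum>a\<in>{a\<in>grid M. a i = k}. A a))}"
  shows "\<exists>B\<in>feas. \<forall>C\<in>feas. (\<Sum>a\<in>grid M. (B a)\<^sup>2) \<le> (\<Sum>a\<in>grid M. (C a)\<^sup>2)"
proof -
  define E :: "(('n \<Rightarrow> nat) \<Rightarrow> real) \<Rightarrow> real" where "E B = (\<Sum>a\<in>grid M. (B a)\<^sup>2)" for B
  have "A \<in> feas" using assms by auto
  have bdd: "bdd_below (E ` feas)" unfolding E_def by (intro bdd_belowI2[of _ 0] sum_nonneg) simp
  define e where "e = Inf (E ` feas)"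
  have "\<exists>B\<in>feas. E B < e + 1 / Suc n" for n
    using cInf_lessD[of "E ` feas" "e + 1 / Suc n"] \<open>A \<in> feas\<close> unfolding e_def[symmetric] by auto
  then obtain X where X: "\<And>n. X n \<in> feas" "\<And>n. E (X n) < e + 1 / Suc n" by metis
  have "X n a \<in> {0..1}" if "a \<in> grid M" for n a using X(1)[of n] that by (simp add: feas_def)
  then obtain r l where r: "strict_mono r"
    and l: "\<And>a. a \<in> grid M \<Longrightarrow> l a \<in> {0..1}" "\<And>a. a \<in> grid M \<Longrightarrow> (\<lambda>n. X (r n) a) \<longlonglongrightarrow> l a"
    using common_convergent_subseq[OF finite_grid, of M "\<lambda>a n. X n a"] by blast
  have "(\<Sum>a\<in>{a\<in>grid M. a i = k}. l a) = (\<Sum>a\<in>{a\<in>grid M. a i = k}. A a)" if "k < M" for i k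
  proof (rule LIMSEQ_unique)
    show "(\<lambda>n. \<Sum>a\<in>{a\<in>grid M. a i = k}. X (r n) a) \<longlonglongrightarrow> (\<Sum>a\<in>{a\<in>grid M. a i = k}. l a)"
      using l by (intro tendsto_sum) auto
    show "(\<lambda>n. \<Sum>a\<in>{a\<in>grid M. a i = k}. X (r n) a) \<longlonglongrightarrow> (\<Sum>a\<in>{a\<in>grid M. a i = k}. A a)"
      using X(1) that by (simp add: feas_def)
  qed
  then have "l \<in> feas" using l by (auto simp: feas_def)
  moreover have "E l \<le> E C" if "C \<in> feas" for C
  proof -
    have "(\<lambda>n. E (X (r n))) \<longlonglongrightarrow> E l"
      unfolding E_def using l by (intro tendsto_sum tendsto_power) auto
    moreover have "(\<lambda>n. e + 1 / Suc (r n)) \<longlonglongrightarrow> e + 0"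
      using LIMSEQ_subseq_LIMSEQ[OF lim_1_over_n[THEN LIMSEQ_Suc] r]
      by (intro tendsto_add tendsto_const) (simp add: o_def)
    ultimately have "E l \<le> e"
      using X(2) by (intro LIMSEQ_le[where X = "\<lambda>n. E (X (r n))" and x = "E l" and y = e]) (auto intro: less_imp_le)
    also have "e \<le> E C" unfolding e_def using that bdd by (intro cInf_lower) auto
    finally show ?thesis .
  qed
  ultimately show ?thesis unfolding E_def by blast
qed

text \<open>The least-squares array with the given slab sums is monotone: if it decreased along a line in
  direction \<open>i\<close>, then, the slab sums being nondecreasing, it would increase along a parallel line,
  and moving mass between the four end points would keep all slab sums and lower the sum of squares.\<close>

lemma grid_monotone_rearrangement:
  fixes A :: "('n::finite \<Rightarrow> nat) \<Rightarrow> real"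
  assumes A01: "\<And>a. a \<in> grid M \<Longrightarrow> A a \<in> {0..1}"
    and slab_mono: "\<And>i k k'. k < k' \<Longrightarrow> k' < M \<Longrightarrow>
      (\<Sum>a\<in>{a\<in>grid M. a i = k}. A a) \<le> (\<Sum>a\<in>{a\<in>grid M. a i = k'}. A a)"
  shows "\<exists>B. (\<forall>a\<in>grid M. B a \<in> {0..1}) \<and>
     (\<forall>i. \<forall>k<M. (\<Sum>a\<in>{a\<in>grid M. a i = k}. B a) = (\<Sum>a\<in>{a\<in>grid M. a i = k}. A a)) \<and>
     (\<forall>a\<in>grid M. \<forall>b\<in>grid M. a \<le> b \<longrightarrow> B a \<le> B b)"
proof -
  have "\<exists>B. (\<forall>a\<in>grid M. B a \<in> {0..1}) \<and>
      (\<forall>i. \<forall>k<M. (\<Sum>a\<in>{a\<in>grid M. a i = k}. B a) = (\<Sum>a\<in>{a\<in>grid M. a i = k}. A a)) \<and>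
      (\<forall>C. (\<forall>a\<in>grid M. C a \<in> {0..1}) \<longrightarrow>
        (\<forall>i. \<forall>k<M. (\<Sum>a\<in>{a\<in>grid M. a i = k}. C a) = (\<Sum>a\<in>{a\<in>grid M. a i = k}. A a)) \<longrightarrow>
        (\<Sum>a\<in>grid M. (B a)\<^sup>2) \<le> (\<Sum>a\<in>grid M. (C a)\<^sup>2))"
    using grid_least_squares[of M A, OF A01] by (simp add: Bex_def imp_conjL)
  then obtain B where B01: "\<forall>a\<in>grid M. B a \<in> {0..1}"
    and slab: "\<forall>i. \<forall>k<M. (\<Sum>a\<in>{a\<in>grid M. a i = k}. B a) = (\<Sum>a\<in>{a\<in>grid M. a i = k}. A a)"
    and least: "\<forall>C. (\<forall>a\<in>grid M. C a \<in> {0..1}) \<longrightarrow>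
      (\<forall>i. \<forall>k<M. (\<Sum>a\<in>{a\<in>grid M. a i = k}. C a) = (\<Sum>a\<in>{a\<in>grid M. a i = k}. A a)) \<longrightarrow>
      (\<Sum>a\<in>grid M. (B a)\<^sup>2) \<le> (\<Sum>a\<in>grid M. (C a)\<^sup>2)"
    by (elim exE conjE)
  have "B a \<le> B (a(i := k'))" if a: "a \<in> grid M" and k': "a i < k'" "k' < M" for a i k'
  proof (rule ccontr)
    assume dec: "\<not> ?thesis"
    define k where "k = a i"
    define up :: "('n \<Rightarrow> nat) \<Rightarrow> 'n \<Rightarrow> nat" where "up b = b(i := k')" for b
    let ?S = "{b\<in>grid M. b i = k}"
    have fin: "finite ?S" using finite_grid by (rule finite_subset[rotated]) auto
    have "\<exists>b\<in>?S. B b < B (up b)"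
    proof (rule ccontr)
      assume "\<not> ?thesis"
      then have nonneg: "\<forall>b\<in>?S. 0 \<le> B b - B (up b)" by force
      have "bij_betw up ?S {b\<in>grid M. b i = k'}"
        using k' a unfolding up_def k_def grid_def
        by (intro bij_betw_byWitness[where f' = "\<lambda>b. b(i := a i)"]) auto
      then have "(\<Sum>b\<in>{b\<in>grid M. b i = k'}. B b) = (\<Sum>b\<in>?S. B (up b))"
        by (rule sum.reindex_bij_betw[symmetric])
      moreover have "(\<Sum>b\<in>?S. B b) \<le> (\<Sum>b\<in>{b\<in>grid M. b i = k'}. B b)"
        using slab_mono[of k k' i] k' slab by (simp add: k_def)
      ultimately have "(\<Sum>b\<in>?S. B b - B (up b)) \<le> 0" by (simp add: sum_subtractf)
      moreover have "B a - B (up a) \<le> (\<Sum>b\<in>?S. B b - B (up b))"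
        using nonneg fin a by (intro member_le_sum) (auto simp: k_def)
      ultimately show False using dec by (simp add: up_def)
    qed
    then obtain b where b: "b \<in> grid M" "b i = k" "B b < B (up b)" by blast
    have a': "up a \<in> grid M" and b': "up b \<in> grid M" using a b k' by (auto simp: up_def grid_def)
    have Ba: "B (up a) < B a" using dec by (simp add: up_def)
    have "up a i \<noteq> a i" "up b i \<noteq> b i" "up a i \<noteq> b i" "up b i \<noteq> a i"
      using b(2) k' by (auto simp: up_def k_def)
    then have dist: "a \<noteq> b" "up a \<noteq> a" "up b \<noteq> b" "up a \<noteq> b" "up b \<noteq> a"
      using b(3) Ba by auto
    have "up a \<noteq> up b"
    proof
      assume eq: "up a = up b"
      have "a j = b j" for j 
        using b(2) fun_cong[OF eq, of j] by (cases "j = i") (auto simp: up_def k_def)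
      then show False using dist by auto
    qed
    note dist = dist this
    \<comment> \<open>Half of the smaller gap keeps the four changed values between old values of
      \<open>B\<close>. The linear part of the change in the sum of squares is then at most -8
      \<epsilon>^2, which outweighs the quadratic part 4 \<epsilon>^2.\<close>
    define \<epsilon> where "\<epsilon> = min (B a - B (up a)) (B (up b) - B b) / 2"
    have \<epsilon>: "\<epsilon> > 0" "2 * \<epsilon> \<le> B a - B (up a)" "2 * \<epsilon> \<le> B (up b) - B b"
      unfolding \<epsilon>_def using Ba b(3) by auto
    \<comment> \<open>Mass moves from \<open>a\<close> to \<open>up a\<close> and from
      \<open>up b\<close> to \<open>b\<close>. In direction \<open>i\<close> the changes at
      \<open>a\<close> and \<open>b\<close> cancel, as do those at \<open>up a\<close> and
      \<open>up b\<close>; in every other direction each point shares its slab with its image under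
      \<open>up\<close>, so the changes cancel there too.\<close>
    define p :: "('n \<Rightarrow> nat) \<Rightarrow> real" where
      "p x = of_bool (x = up a) + of_bool (x = b) - of_bool (x = a) - of_bool (x = up b)" for x
    have sum_delta: "(\<Sum>x\<in>S. g x * of_bool (x = y)) = (if y \<in> S then g y else 0)"
      if "finite S" for S y and g :: "('n \<Rightarrow> nat) \<Rightarrow> real"
      using that by (simp add: of_bool_def if_distrib[of "\<lambda>z. g _ * z"] cong: if_cong)
    have sum_p: "(\<Sum>x\<in>S. g x * p x) = (if up a \<in> S then g (up a) else 0) + (if b \<in> S then g b else 0)
        - (if a \<in> S then g a else 0) - (if up b \<in> S then g (up b) else 0)"
      if "finite S" for S and g :: "('n \<Rightarrow> nat) \<Rightarrow> real"
      using that by (simp add: p_def algebra_simps sum.distrib sum_subtractf sum_delta)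
    define C where "C x = B x + \<epsilon> * p x" for x
    have "C x \<in> {0..1}" if "x \<in> grid M" for x
    proof -
      have "B x \<in> {0..1}" "B a \<in> {0..1}" "B b \<in> {0..1}" "B (up a) \<in> {0..1}" "B (up b) \<in> {0..1}"
        using that a b(1) a' b' B01 by auto
      moreover have "C x = (if x = up a then B (up a) + \<epsilon> else if x = b then B b + \<epsilon>
          else if x = a then B a - \<epsilon> else if x = up b then B (up b) - \<epsilon> else B x)"
        using dist by (auto simp: C_def p_def)
      ultimately show ?thesis using \<epsilon> by auto
    qed
    moreover have "(\<Sum>x\<in>{x\<in>grid M. x j = l}. C x) = (\<Sum>x\<in>{x\<in>grid M. x j = l}. A x)" if "l < M" for j l
    proof -
      have "(\<Sum>x\<in>{x\<in>grid M. x j = l}. 1 * p x) = 0"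
        using a a' b b' by (subst sum_p) (auto simp: up_def k_def finite_grid)
      then show ?thesis
        unfolding C_def sum.distrib sum_distrib_left[symmetric] using slab that by simp
    qed
    ultimately have "(\<Sum>x\<in>grid M. (B x)\<^sup>2) \<le> (\<Sum>x\<in>grid M. (C x)\<^sup>2)"
      by (intro least[rule_format]) auto
    also have "\<dots> = (\<Sum>x\<in>grid M. (B x)\<^sup>2 + (2 * \<epsilon> * (B x * p x) + \<epsilon>\<^sup>2 * (p x * p x)))"
      by (intro sum.cong) (auto simp: C_def power2_eq_square algebra_simps)
    also have "\<dots> = (\<Sum>x\<in>grid M. (B x)\<^sup>2) + (2 * \<epsilon> * (\<Sum>x\<in>grid M. B x * p x) + \<epsilon>\<^sup>2 * (\<Sum>x\<in>grid M. p x * p x))"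
      by (simp only: sum.distrib sum_distrib_left)
    also have "(\<Sum>x\<in>grid M. p x * p x) = 4"
      using a a' b(1) b' dist by (subst sum_p) (auto simp: p_def finite_grid)
    also have "(\<Sum>x\<in>grid M. B x * p x) = B (up a) + B b - B a - B (up b)"
      using a a' b(1) b' by (subst sum_p) (auto simp: finite_grid)
    finally have "0 \<le> 2 * \<epsilon> * (B (up a) + B b - B a - B (up b)) + \<epsilon>\<^sup>2 * 4" by simp
    moreover have "2 * \<epsilon> * (B (up a) + B b - B a - B (up b)) \<le> 2 * \<epsilon> * (- 4 * \<epsilon>)"
      using \<epsilon> by (intro mult_left_mono) auto
    moreover have "\<epsilon>\<^sup>2 > 0" using \<epsilon> by simp
    ultimately show False by (simp add: power2_eq_square)
  qed
  then have "B a \<le> B b" if "a \<in> grid M" "b \<in> grid M" "a \<le> b" for a b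
    using grid_mono_if_coordinatewise[of M B a b] that by blast
  then show ?thesis using B01 slab by blast
qed

section \<open>Marginals on the cube\<close>

definition cube_measure :: "('n::finite \<Rightarrow> real) measure" where
  "cube_measure = (\<Pi>\<^sub>M i\<in>UNIV. unit_measure)"

definition marginal :: "(('n::finite \<Rightarrow> real) \<Rightarrow> real) \<Rightarrow> 'n \<Rightarrow> real \<Rightarrow> real" where
  "marginal f i t = (\<integral>y. f (y(i := t)) \<partial>(\<Pi>\<^sub>M k\<in>UNIV - {i}. unit_measure))"

lemma rationalizes_iff:
  "rationalizes f q \<longleftrightarrow> f \<in> borel_measurable cube_measure \<and> (\<forall>x\<in>unit_cube. f x \<in> {0..1}) \<and>
     (\<forall>i. AE t in unit_measure. q i t = marginal f i t)"
  by (simp add: rationalizes_def cube_measure_def marginal_def)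

lemma emeasure_unit_measure_space: "emeasure unit_measure {0..1} = 1"
  by (simp add: emeasure_restrict_space)

interpretation unit: finite_measure unit_measure
  by (rule finite_measureI) (simp add: emeasure_unit_measure_space space_restrict_space)

interpretation unit_prod: product_sigma_finite "\<lambda>_::'n::finite. unit_measure"
  by (simp add: product_sigma_finite_def unit.sigma_finite_measure_axioms)

lemma emeasure_PiM_unit_space:
  fixes I :: "'n::finite set"
  shows "emeasure (\<Pi>\<^sub>M i\<in>I. unit_measure) (space (\<Pi>\<^sub>M i\<in>I. unit_measure)) = 1"
  unfolding space_PiM
  by (subst unit_prod.emeasure_PiM) (auto simp: space_restrict_space emeasure_unit_measure_space)

lemma finite_measure_PiM_unit: "finite_measure (\<Pi>\<^sub>M i\<in>(I::'n::finite set). unit_measure)"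
  by (rule finite_measureI) (simp add: emeasure_PiM_unit_space)

lemma measure_PiM_unit_space [simp]:
  fixes I :: "'n::finite set"
  shows "measure (\<Pi>\<^sub>M i\<in>I. unit_measure) (space (\<Pi>\<^sub>M i\<in>I. unit_measure)) = 1"
  by (simp add: measure_def emeasure_PiM_unit_space)

interpretation cube: finite_measure cube_measure
  unfolding cube_measure_def by (rule finite_measure_PiM_unit)

lemma space_cube_measure: "space cube_measure = unit_cube"
  by (auto simp: cube_measure_def space_PiM space_restrict_space unit_cube_def PiE_def)

lemma measurable_cube_component [measurable]: "(\<lambda>x. x i) \<in> measurable cube_measure unit_measure"
  unfolding cube_measure_def by measurable

lemma cube_integrable:
  assumes "f \<in> borel_measurable cube_measure" "\<And>x. x \<in> unit_cube \<Longrightarrow> \<bar>f x\<bar> \<le> (C::real)"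
  shows "integrable cube_measure f"
  using assms by (intro cube.integrable_const_bound[where B = C] AE_I2) (auto simp: space_cube_measure)

lemma unit_integrable:
  assumes "f \<in> borel_measurable unit_measure" "\<And>t. t \<in> {0..1} \<Longrightarrow> \<bar>f t\<bar> \<le> (C::real)"
  shows "integrable unit_measure f"
  using assms by (intro unit.integrable_const_bound[where B = C] AE_I2) (auto simp: space_restrict_space)

lemma fun_upd_in_unit_cube:
  "y \<in> space (\<Pi>\<^sub>M k\<in>UNIV - {i}. unit_measure) \<Longrightarrow> t \<in> {0..1} \<Longrightarrow> y(i := t) \<in> unit_cube"
  by (auto simp: space_PiM space_restrict_space unit_cube_def PiE_def Pi_def)

lemma measurable_slice:
  fixes f :: "('n::finite \<Rightarrow> real) \<Rightarrow> real"
  assumes "f \<in> borel_measurable cube_measure"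
  shows "(\<lambda>(t, y). f (y(i := t))) \<in>
    borel_measurable (unit_measure \<Otimes>\<^sub>M (\<Pi>\<^sub>M k\<in>UNIV - {i}. unit_measure))"
proof -
  have "(\<lambda>z. (snd z)(i := fst z)) \<in>
      measurable (unit_measure \<Otimes>\<^sub>M (\<Pi>\<^sub>M k\<in>UNIV - {i}. unit_measure)) (cube_measure :: ('n \<Rightarrow> real) measure)"
    unfolding cube_measure_def by (rule measurable_fun_upd[where J = "UNIV - {i}"]) auto
  from measurable_compose[OF this assms] show ?thesis by (simp add: case_prod_beta)
qed

lemma slice_integrable:
  fixes f :: "('n::finite \<Rightarrow> real) \<Rightarrow> real"
  assumes "f \<in> borel_measurable cube_measure" "\<And>x. x \<in> unit_cube \<Longrightarrow> \<bar>f x\<bar> \<le> C" "t \<in> {0..1}"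
  shows "integrable (\<Pi>\<^sub>M k\<in>UNIV - {i}. unit_measure) (\<lambda>y. f (y(i := t)))"
proof -
  interpret finite_measure "\<Pi>\<^sub>M k\<in>UNIV - {i}. unit_measure" by (rule finite_measure_PiM_unit)
  show ?thesis
  proof (rule integrable_const_bound[where B = C])
    show "AE y in \<Pi>\<^sub>M k\<in>UNIV - {i}. unit_measure. norm (f (y(i := t))) \<le> C"
      using assms(2,3) fun_upd_in_unit_cube by (intro AE_I2) auto
    show "(\<lambda>y. f (y(i := t))) \<in> borel_measurable (\<Pi>\<^sub>M k\<in>UNIV - {i}. unit_measure)"
      using measurable_Pair2[OF measurable_slice[OF assms(1), of i], of t] assms(3)
      by (simp add: space_restrict_space)
  qed
qed

lemma measurable_marginal:
  assumes "f \<in> borel_measurable cube_measure"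
  shows "marginal f i \<in> borel_measurable unit_measure"
proof -
  interpret finite_measure "\<Pi>\<^sub>M k\<in>UNIV - {i}. unit_measure" by (rule finite_measure_PiM_unit)
  show ?thesis
    unfolding marginal_def using measurable_slice[OF assms]
    by (rule borel_measurable_lebesgue_integral)
qed

lemma marginal_mono:
  assumes "f \<in> borel_measurable cube_measure" "\<And>x. x \<in> unit_cube \<Longrightarrow> \<bar>f x\<bar> \<le> C"
    and "g \<in> borel_measurable cube_measure" "\<And>x. x \<in> unit_cube \<Longrightarrow> \<bar>g x\<bar> \<le> D"
    and "s \<in> {0..1}" "t \<in> {0..1}"
    and "\<And>y. y(i := s) \<in> unit_cube \<Longrightarrow> y(i := t) \<in> unit_cube \<Longrightarrow> f (y(i := s)) \<le> g (y(i := t))"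
  shows "marginal f i s \<le> marginal g i t"
  unfolding marginal_def
  by (intro integral_mono slice_integrable[OF assms(1,2,5)] slice_integrable[OF assms(3,4,6)] assms(7)
      fun_upd_in_unit_cube assms(5,6))

lemma marginal_const [simp]: "marginal (\<lambda>_. c) i t = c"
  by (simp add: marginal_def)

lemma marginal_range:
  assumes "f \<in> borel_measurable cube_measure" "\<And>x. x \<in> unit_cube \<Longrightarrow> f x \<in> {0..1}" "t \<in> {0..1}"
  shows "marginal f i t \<in> {0..1}"
proof -
  have b: "\<bar>f x\<bar> \<le> 1" if "x \<in> unit_cube" for x using assms(2)[OF that] by auto
  have "marginal (\<lambda>_. 0) i t \<le> marginal f i t"
    using assms by (intro marginal_mono[where C = 1 and D = 1] b) auto
  moreover have "marginal f i t \<le> marginal (\<lambda>_. 1) i t"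
    using assms by (intro marginal_mono[where C = 1 and D = 1] b) auto
  ultimately show ?thesis by simp
qed

lemma marginal_cmult: "marginal (\<lambda>x. c * f x) i t = c * marginal f i t"
  by (simp add: marginal_def)

text \<open>Fubini with coordinate \<open>i\<close> split off: \<open>b (x i)\<close> is constant on
  each slice and leaves the inner integral.\<close>

lemma integral_marginal:
  fixes f :: "('n::finite \<Rightarrow> real) \<Rightarrow> real"
  assumes [measurable]: "f \<in> borel_measurable cube_measure" "b \<in> borel_measurable unit_measure"
    and C: "\<And>x. x \<in> unit_cube \<Longrightarrow> \<bar>f x\<bar> \<le> C" and D: "\<And>t. t \<in> {0..1} \<Longrightarrow> \<bar>b t\<bar> \<le> D"
  shows "(\<integral>x. f x * b (x i) \<partial>cube_measure) = (\<integral>t. marginal f i t * b t \<partial>unit_measure)"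
proof -
  define g where "g x = f x * b (x i)" for x
  have g_meas [measurable]: "g \<in> borel_measurable cube_measure"
    unfolding g_def by measurable
  have g_bound: "\<bar>g x\<bar> \<le> C * D" if "x \<in> unit_cube" for x
  proof -
    have "\<bar>b (x i)\<bar> \<le> D" using that by (intro D) (auto simp: unit_cube_def)
    then show ?thesis
      unfolding g_def abs_mult using C[OF that] by (intro mult_mono) (auto intro: order_trans[OF abs_ge_zero])
  qed
  have "integrable cube_measure g" using g_meas g_bound by (rule cube_integrable)
  then have "integral\<^sup>L cube_measure g
      = (\<integral>x. (\<integral>y. g (merge {i} (UNIV - {i}) (x, y)) \<partial>(\<Pi>\<^sub>M k\<in>UNIV - {i}. unit_measure))
          \<partial>(\<Pi>\<^sub>M k\<in>{i}. unit_measure))"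
    unfolding cube_measure_def
    using unit_prod.product_integral_fold[of "{i}" "UNIV - {i}" g] by (simp add: insert_Diff_if)
  also have "\<dots> = (\<integral>x. marginal g i (x i) \<partial>(\<Pi>\<^sub>M k\<in>{i}. unit_measure))"
  proof -
    have "merge {i} (UNIV - {i}) (x, y) = y(i := x i)" for x y :: "'n \<Rightarrow> real"
      by (auto simp: merge_def)
    then show ?thesis by (simp add: marginal_def)
  qed
  also have "\<dots> = integral\<^sup>L unit_measure (marginal g i)"
    using measurable_marginal[OF g_meas] by (rule unit_prod.product_integral_singleton)
  also have "\<dots> = (\<integral>t. marginal f i t * b t \<partial>unit_measure)"
    unfolding marginal_def g_def by (intro Bochner_Integration.integral_cong) auto
  finally show ?thesis by (simp add: g_def[abs_def])
qed

text \<open>Marginals of a monotone function are nondecreasing but may fail to be left-continuous,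
  which \<open>rationalizable_tuples\<close> demands. For nondecreasing \<open>u\<close> the
  supremum over [0,t) is the left limit; at 0 there is nothing to the left and \<open>u 0\<close> is
  kept.\<close>

definition left_version :: "(real \<Rightarrow> real) \<Rightarrow> real \<Rightarrow> real" where
  "left_version u t = (if t \<le> 0 then u 0 else Sup (u ` {0..<t}))"

context
  fixes u :: "real \<Rightarrow> real"
  assumes u_mono: "mono_on {0..1} u" and u01: "\<And>t. t \<in> {0..1} \<Longrightarrow> u t \<in> {0..1}"
begin

lemma left_version_upper: "0 \<le> s \<Longrightarrow> s < t \<Longrightarrow> t \<le> 1 \<Longrightarrow> u s \<le> left_version u t"
proof -
  assume "0 \<le> s" "s < t" "t \<le> 1"
  then have "u s \<le> Sup (u ` {0..<t})"
    using u01 by (intro cSup_upper bdd_aboveI2[of _ _ 1]) (auto simp: less_imp_le)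
  then show ?thesis using \<open>0 \<le> s\<close> \<open>s < t\<close> by (simp add: left_version_def)
qed

lemma left_version_least:
  assumes "0 < t" "\<And>s. 0 \<le> s \<Longrightarrow> s < t \<Longrightarrow> u s \<le> c"
  shows "left_version u t \<le> c"
  unfolding left_version_def using assms by (auto intro!: cSup_least)

lemma left_version_le: "0 \<le> t \<Longrightarrow> t \<le> 1 \<Longrightarrow> left_version u t \<le> u t"
  by (cases "t = 0") (auto simp: left_version_def[of _ 0] intro!: left_version_least mono_onD[OF u_mono])

lemma left_version_mono: "mono_on {0..1} (left_version u)"
proof (rule mono_onI)
  fix s t :: real assume st: "s \<in> {0..1}" "t \<in> {0..1}" "s \<le> t"
  show "left_version u s \<le> left_version u t"
  proof (cases "s = t")
    case False
    then show ?thesis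
      using st left_version_le[of s] left_version_upper[of s t] by auto
  qed simp
qed

lemma left_version_range: "t \<in> {0..1} \<Longrightarrow> left_version u t \<in> {0..1}"
  using left_version_le[of t] left_version_upper[of 0 t] u01[of t] u01[of 0]
  by (cases "t = 0") (auto simp: left_version_def[of _ 0])

lemma left_version_continuous: "t \<in> {0<..1} \<Longrightarrow> continuous (at_left t) (left_version u)"
  unfolding continuous_within
proof (rule order_tendstoI)
  fix a assume t: "t \<in> {0<..1}" and "a < left_version u t"
  then have "\<exists>s. 0 \<le> s \<and> s < t \<and> a < u s"
    using left_version_least[of t a] by force
  then obtain s where s: "0 \<le> s" "s < t" "a < u s" by blast
  have "a < left_version u r" if "s < r" "r < t" for r
    using left_version_upper[of s r] s that t by auto
  then show "eventually (\<lambda>r. a < left_version u r) (at_left t)"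
    unfolding eventually_at_left_field using s by blast
next
  fix a assume t: "t \<in> {0<..1}" and a: "left_version u t < a"
  have "left_version u r < a" if "0 < r" "r < t" for r
    using mono_onD[OF left_version_mono, of r t] that t a by auto
  then show "eventually (\<lambda>r. left_version u r < a) (at_left t)"
    unfolding eventually_at_left_field using t by auto
qed

text \<open>A nondecreasing function has only countably many discontinuities, and at a point of
  continuity \<open>t > 0\<close> the left limit is the value.\<close>

lemma left_version_AE: "AE t in unit_measure. left_version u t = u t"
proof -
  let ?D = "{t\<in>{0..1}. \<not> continuous (at t within {0..1}) u}"
  have "?D \<in> null_sets lebesgue"
    by (intro null_sets_completionI countable_imp_null_set_lborel mono_on_ctble_discont[OF u_mono])
  moreover have "left_version u t = u t" if "t \<in> {0..1}" "t \<notin> ?D" for t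
  proof (cases "t = 0")
    case False
    have "u t \<le> left_version u t"
    proof (rule ccontr)
      assume "\<not> ?thesis"
      moreover have "(u \<longlongrightarrow> u t) (at t within {0..1})"
        using that by (auto simp: continuous_within)
      ultimately have "eventually (\<lambda>s. left_version u t < u s) (at t within {0..1})"
        by (intro order_tendstoD(1)) auto
      then obtain d where d: "d > 0" "\<And>s. s \<in> {0..1} \<Longrightarrow> s \<noteq> t \<Longrightarrow> dist s t < d \<Longrightarrow> left_version u t < u s"
        unfolding eventually_at by blast
      define s where "s = max 0 (t - d / 2)"
      have "s \<in> {0..1}" "s < t" "dist s t < d" using that False d(1) by (auto simp: s_def dist_real_def)
      then show False using d(2)[of s] left_version_upper[of s t] that by auto
    qed
    then show ?thesis using left_version_le[of t] that by auto
  qed (simp add: left_version_def)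
  ultimately show ?thesis
    by (subst AE_restrict_space_iff) (auto intro: AE_I')
qed

end

text \<open>Monotonicity makes all marginals nondecreasing, so that each such function yields a
  member of \<open>rationalizable_tuples\<close> through the left versions of its marginals. This is
  the source of all competitors in the extreme point argument.\<close>

definition admissible :: "(('n::finite \<Rightarrow> real) \<Rightarrow> real) \<Rightarrow> bool" where
  "admissible f \<longleftrightarrow> f \<in> borel_measurable cube_measure \<and> (\<forall>x\<in>unit_cube. f x \<in> {0..1}) \<and> mono_on unit_cube f"

lemma admissible_bounded: "admissible f \<Longrightarrow> x \<in> unit_cube \<Longrightarrow> \<bar>f x\<bar> \<le> 1"
  by (auto simp: admissible_def abs_le_iff intro: order_trans[of _ 0])

lemma admissible_marginal:
  assumes "admissible f"
  shows "mono_on {0..1} (marginal f i)" "t \<in> {0..1} \<Longrightarrow> marginal f i t \<in> {0..1}"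
proof -
  have *: "f (y(i := s)) \<le> f (y(i := t))" if "y(i := s) \<in> unit_cube" "y(i := t) \<in> unit_cube" "s \<le> t" for y s t
    using assms that by (auto simp: admissible_def le_fun_def intro!: mono_onD[of unit_cube f])
  show "mono_on {0..1} (marginal f i)"
    using assms admissible_bounded[OF assms] *
    by (intro mono_onI marginal_mono[where C = 1 and D = 1]) (auto simp: admissible_def)
  show "t \<in> {0..1} \<Longrightarrow> marginal f i t \<in> {0..1}"
    using assms by (intro marginal_range) (auto simp: admissible_def)
qed

lemma left_marginals_rationalized:
  assumes "admissible f"
  shows "rationalizes f (\<lambda>i. left_version (marginal f i))"
    and "(\<lambda>i. left_version (marginal f i)) \<in> rationalizable_tuples"
proof -
  note m = admissible_marginal[OF assms]
  show 1: "rationalizes f (\<lambda>i. left_version (marginal f i))"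
    using assms left_version_AE[OF m] by (auto simp: rationalizes_iff admissible_def)
  show "(\<lambda>i. left_version (marginal f i)) \<in> rationalizable_tuples"
    unfolding rationalizable_tuples_def
    by (intro CollectI conjI allI ballI exI[of _ f] 1 left_version_mono[OF m]
        left_version_continuous[OF m] left_version_range[OF m])
qed

text \<open>Dominated convergence on each slice gives convergence of the marginals at every point of
  [0,1]; the exceptional null sets of the countably many \<open>F n\<close> are united. With a
  constant sequence the lemma also allows changing a rationalizing function to one with the same
  values on the cube.\<close>

lemma rationalizes_limit:
  fixes f :: "('n::finite \<Rightarrow> real) \<Rightarrow> real"
  assumes rat: "\<And>n. rationalizes (F n) q"
    and lim: "\<And>x. x \<in> unit_cube \<Longrightarrow> (\<lambda>n. F n x) \<longlonglongrightarrow> f x"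
  shows "rationalizes f q"
proof -
  have F: "F n \<in> borel_measurable cube_measure" "\<And>x. x \<in> unit_cube \<Longrightarrow> F n x \<in> {0..1}"
    "\<And>i. AE t in unit_measure. q i t = marginal (F n) i t" for n
    using rat[of n] by (auto simp: rationalizes_iff)
  have meas: "f \<in> borel_measurable cube_measure"
  proof (rule borel_measurable_LIMSEQ_real)
    show "(\<lambda>n. F n x) \<longlonglongrightarrow> f x" if "x \<in> space cube_measure" for x
      using lim that by (simp add: space_cube_measure)
  qed (rule F(1))
  have "AE t in unit_measure. q i t = marginal f i t" for i
  proof -
    have conv: "(\<lambda>n. marginal (F n) i t) \<longlonglongrightarrow> marginal f i t" if t: "t \<in> {0..1}" for t
    proof -
      interpret finite_measure "\<Pi>\<^sub>M k\<in>UNIV - {i}. unit_measure" by (rule finite_measure_PiM_unit)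
      have bounded: "\<And>n x. x \<in> unit_cube \<Longrightarrow> \<bar>F n x\<bar> \<le> 1" "\<And>x. x \<in> unit_cube \<Longrightarrow> \<bar>f x\<bar> \<le> 1"
      proof -
        show 1: "\<bar>F n x\<bar> \<le> 1" if "x \<in> unit_cube" for n x using F(2)[OF that, of n] by auto
        show "\<bar>f x\<bar> \<le> 1" if "x \<in> unit_cube" for x
          using tendsto_rabs[OF lim[OF that]] 1[OF that] by (intro LIMSEQ_le_const2) auto
      qed
      show ?thesis
        unfolding marginal_def
      proof (rule integral_dominated_convergence[where w = "\<lambda>_. 1"])
        show "(\<lambda>y. f (y(i := t))) \<in> borel_measurable (\<Pi>\<^sub>M k\<in>UNIV - {i}. unit_measure)"
          using slice_integrable[OF meas bounded(2) t, of i] by auto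
        show "(\<lambda>y. F n (y(i := t))) \<in> borel_measurable (\<Pi>\<^sub>M k\<in>UNIV - {i}. unit_measure)" for n
        proof -
          have "\<And>x. x \<in> unit_cube \<Longrightarrow> \<bar>F n x\<bar> \<le> 1" by (rule bounded(1))
          from slice_integrable[OF F(1) this t, of i] show ?thesis by auto
        qed
      qed (use lim bounded t in \<open>auto intro!: AE_I2 simp: fun_upd_in_unit_cube\<close>)
    qed
    have "AE t in unit_measure. \<forall>n. q i t = marginal (F n) i t"
      using F(3) by (subst AE_all_countable) auto
    then show ?thesis
    proof (rule AE_mp[OF _ AE_I2], safe)
      fix t assume "t \<in> space unit_measure" and eq: "\<forall>n. q i t = marginal (F n) i t"
      then have "t \<in> {0..1}" by (simp add: space_restrict_space)
      from conv[OF this] eq have "(\<lambda>n. q i t) \<longlonglongrightarrow> marginal f i t" by simp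
      then show "q i t = marginal f i t" by (simp add: LIMSEQ_const_iff)
    qed
  qed
  moreover have "f x \<in> {0..1}" if "x \<in> unit_cube" for x
    using closed_sequentially[OF closed_atLeastAtMost F(2)[OF that] lim[OF that]] .
  ultimately show ?thesis using meas by (auto simp: rationalizes_iff)
qed

section \<open>Monotone rationalization\<close>

text \<open>Cell \<open>k\<close> is [k/M, (k+1)/M), except that the \<open>min\<close> puts the end
  point 1 into the last cell.\<close>

definition cell_index :: "nat \<Rightarrow> real \<Rightarrow> nat" where
  "cell_index M t = min (M - 1) (nat \<lfloor>real M * t\<rfloor>)"

lemma cell_index_less: "M > 0 \<Longrightarrow> cell_index M t < M"
  by (auto simp: cell_index_def min_def)

lemma cell_index_mono: "s \<le> t \<Longrightarrow> cell_index M s \<le> cell_index M t"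
  unfolding cell_index_def by (intro min.mono nat_mono floor_mono mult_left_mono) auto

lemma cell_index_less_iff:
  assumes "k < M" "0 \<le> t"
  shows "cell_index M t < k \<longleftrightarrow> t < real k / real M"
proof -
  have "cell_index M t < k \<longleftrightarrow> nat \<lfloor>real M * t\<rfloor> < k"
    using assms(1) by (auto simp: cell_index_def min_def)
  also have "\<dots> \<longleftrightarrow> \<lfloor>real M * t\<rfloor> < int k" using assms by (simp add: nat_less_iff)
  also have "\<dots> \<longleftrightarrow> real M * t < real k" by (simp add: floor_less_iff)
  also have "\<dots> \<longleftrightarrow> t < real k / real M" using assms by (simp add: field_simps)
  finally show ?thesis .
qed

definition cell :: "nat \<Rightarrow> nat \<Rightarrow> real set" where
  "cell M k = {t\<in>{0..1}. cell_index M t = k}"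

lemma unit_measurable_ident [measurable]: "(\<lambda>t. t) \<in> borel_measurable unit_measure"
  by (intro measurable_restrict_space1 measurable_completion) simp

lemma mono_on_unit_measurable:
  fixes u :: "real \<Rightarrow> real"
  assumes "mono_on {0..1} u"
  shows "u \<in> borel_measurable unit_measure"
proof -
  have "(\<lambda>t. t) \<in> measurable unit_measure (restrict_space borel {0..1})"
    by (intro measurable_restrict_space3 measurable_completion) auto
  from measurable_compose[OF this borel_measurable_mono_on_fnc[OF assms]] show ?thesis .
qed

lemma cell_index_measurable [measurable]: "cell_index M \<in> measurable unit_measure (count_space UNIV)"
  unfolding cell_index_def[abs_def] by measurable

lemma cell_sets [measurable]: "cell M k \<in> sets unit_measure"
proof -
  have "cell M k = {t \<in> space unit_measure. cell_index M t = k}"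
    by (auto simp: cell_def space_restrict_space)
  also have "\<dots> \<in> sets unit_measure" by measurable
  finally show ?thesis .
qed

lemma measure_cell:
  assumes "k < M"
  shows "measure unit_measure (cell M k) = 1 / real M"
proof -
  let ?S = "\<lambda>k. {t\<in>{0..1}. cell_index M t < k}"
  have sets: "?S k \<in> sets unit_measure" for k
  proof -
    have "?S k = {t \<in> space unit_measure. cell_index M t < k}" by (auto simp: space_restrict_space)
    also have "\<dots> \<in> sets unit_measure" by measurable
    finally show ?thesis .
  qed
  have meas: "measure unit_measure (?S k) = real k / real M" if "k \<le> M" for k
  proof (cases "k = M")
    case True
    then have "?S k = {0..1}" using cell_index_less[of M] assms by auto
    then show ?thesis using True assms emeasure_unit_measure_space by (simp add: measure_def)
  next
    case False
    then have "k < M" using that by simp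
    have lt1: "real k / real M < 1" using \<open>k < M\<close> by simp
    have "?S k = {0..<real k / real M}"
      using lt1 cell_index_less_iff[OF \<open>k < M\<close>] by auto
    moreover have "measure unit_measure {0..<real k / real M} = measure lebesgue {0..<real k / real M}"
      using lt1 by (intro measure_restrict_space) auto
    ultimately show ?thesis by simp
  qed
  have "cell M k = ?S (Suc k) - ?S k" by (auto simp: cell_def)
  then have "measure unit_measure (cell M k) = measure unit_measure (?S (Suc k)) - measure unit_measure (?S k)"
    using sets by (simp only:) (intro unit.finite_measure_Diff, auto)
  also have "\<dots> = real (Suc k) / real M - real k / real M" using assms by (simp only: meas Suc_leI less_imp_le)
  finally show ?thesis by (simp add: diff_divide_distrib[symmetric])
qed

text \<open>The averages of \<open>f\<close> over the cells form an array whose slab sums are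
  multiples of the integrals of \<open>q i\<close> over the cells, hence nondecreasing; its monotone
  rearrangement, read as a step function, is \<open>F\<close>. The conclusion uses integrals over
  half-lines because the thresholds k/M reappear among those of every refinement, so that conditions
  on different grids can be compared.\<close>

lemma grid_approximation:
  fixes f :: "('n::finite \<Rightarrow> real) \<Rightarrow> real"
  assumes rat: "rationalizes f q"
    and q_mono: "\<And>i. mono_on {0..1} (q i)" and q01: "\<And>i t. t \<in> {0..1} \<Longrightarrow> q i t \<in> {0..1}"
    and M: "M > 0"
  shows "\<exists>F. admissible F \<and> (\<forall>i. \<forall>k<M.
      (\<integral>x. F x * indicator {..<real k / real M} (x i) \<partial>cube_measure)
        = (\<integral>x. f x * indicator {..<real k / real M} (x i) \<partial>cube_measure))"
proof -
  have f [measurable]: "f \<in> borel_measurable cube_measure" and f01: "\<And>x. x \<in> unit_cube \<Longrightarrow> f x \<in> {0..1}"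
    and q: "\<And>i. AE t in unit_measure. q i t = marginal f i t"
    using rat by (auto simp: rationalizes_iff)
  have f_bound: "\<bar>f x\<bar> \<le> 1" if "x \<in> unit_cube" for x using f01[OF that] by auto
  define Q :: "('n \<Rightarrow> nat) \<Rightarrow> ('n \<Rightarrow> real) set" where "Q a = {x. \<forall>i. x i \<in> cell M (a i)}" for a
  define idx :: "('n \<Rightarrow> real) \<Rightarrow> 'n \<Rightarrow> nat" where "idx x = (\<lambda>i. cell_index M (x i))" for x
  define c where "c = (1 / real M) ^ CARD('n)"
  have c: "c > 0" using M by (simp add: c_def)
  have Q_PiE: "Q a = (\<Pi>\<^sub>E i\<in>UNIV. cell M (a i))" for a
    by (auto simp: Q_def PiE_def Pi_def)
  have Q_sets [measurable]: "Q a \<in> sets cube_measure" for a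
    unfolding Q_PiE cube_measure_def by (intro sets_PiM_I_finite) auto
  have Q_measure: "measure cube_measure (Q a) = c" if "a \<in> grid M" for a
  proof -
    have "emeasure unit_measure (cell M (a i)) = ennreal (1 / real M)" for i
      using measure_cell[of "a i" M] that by (simp add: unit.emeasure_eq_measure grid_def)
    then have "emeasure cube_measure (Q a) = ennreal (1 / real M) ^ CARD('n)"
      unfolding Q_PiE cube_measure_def by (subst unit_prod.emeasure_PiM) auto
    then show ?thesis by (simp add: measure_def c_def ennreal_power)
  qed
  have idx: "idx x \<in> grid M" for x using M by (simp add: idx_def grid_def cell_index_less)
  have Q_iff: "x \<in> Q a \<longleftrightarrow> idx x = a" if "x \<in> unit_cube" for x a
    using that by (auto simp: Q_def idx_def cell_def unit_cube_def fun_eq_iff)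
  have cell_iff: "x i \<in> cell M k \<longleftrightarrow> idx x i = k" if "x \<in> unit_cube" for x i k
    using that by (auto simp: idx_def cell_def unit_cube_def)
  have int_mult: "integrable cube_measure (\<lambda>x. g x * h x)"
    if "g \<in> borel_measurable cube_measure" "h \<in> borel_measurable cube_measure"
      "\<And>x. x \<in> unit_cube \<Longrightarrow> \<bar>g x\<bar> \<le> 1" "\<And>x. x \<in> unit_cube \<Longrightarrow> \<bar>h x\<bar> \<le> 1" for g h :: "('n \<Rightarrow> real) \<Rightarrow> real"
    using that by (intro cube_integrable[where C = 1]) (auto simp: abs_mult intro!: mult_le_one)
  have slab_meas [measurable]: "(\<lambda>x. indicator (cell M k) (x i) :: real) \<in> borel_measurable cube_measure" for k i
    by measurable
  have slab: "(\<integral>x. g x * indicator (cell M k) (x i) \<partial>cube_measure)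
      = (\<Sum>a\<in>{a\<in>grid M. a i = k}. \<integral>x. g x * indicator (Q a) x \<partial>cube_measure)"
    if g [measurable]: "g \<in> borel_measurable cube_measure" and b: "\<And>x. x \<in> unit_cube \<Longrightarrow> \<bar>g x\<bar> \<le> 1"
    for g :: "('n \<Rightarrow> real) \<Rightarrow> real" and i k
  proof -
    have eq: "(\<Sum>a\<in>{a\<in>grid M. a i = k}. g x * indicator (Q a) x) = g x * indicator (cell M k) (x i)"
      if x: "x \<in> unit_cube" for x
    proof -
      have "(\<Sum>a\<in>{a\<in>grid M. a i = k}. g x * indicator (Q a) x)
          = (\<Sum>a\<in>{a\<in>grid M. a i = k}. if a = idx x then g x else 0)"
        by (intro sum.cong) (auto simp: indicator_def Q_iff[OF x])
      also have "\<dots> = g x * indicator (cell M k) (x i)"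
        using idx by (subst sum.delta) (auto simp: finite_grid cell_iff[OF x] indicator_def)
      finally show ?thesis .
    qed
    have "(\<integral>x. g x * indicator (cell M k) (x i) \<partial>cube_measure)
        = (\<integral>x. (\<Sum>a\<in>{a\<in>grid M. a i = k}. g x * indicator (Q a) x) \<partial>cube_measure)"
      by (intro Bochner_Integration.integral_cong refl) (simp only: space_cube_measure eq)
    also have "\<dots> = (\<Sum>a\<in>{a\<in>grid M. a i = k}. \<integral>x. g x * indicator (Q a) x \<partial>cube_measure)"
      by (intro Bochner_Integration.integral_sum int_mult g b) (auto simp: indicator_def)
    finally show ?thesis .
  qed
  have cumulative: "(\<integral>x. g x * indicator {..<real k / real M} (x i) \<partial>cube_measure)
      = (\<Sum>l<k. \<integral>x. g x * indicator (cell M l) (x i) \<partial>cube_measure)"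
    if g [measurable]: "g \<in> borel_measurable cube_measure" and b: "\<And>x. x \<in> unit_cube \<Longrightarrow> \<bar>g x\<bar> \<le> 1"
      and k: "k < M" for g :: "('n \<Rightarrow> real) \<Rightarrow> real" and i k
  proof -
    have eq: "(\<Sum>l<k. g x * indicator (cell M l) (x i)) = g x * indicator {..<real k / real M} (x i)"
      if x: "x \<in> unit_cube" for x
    proof -
      have "(\<Sum>l<k. g x * indicator (cell M l) (x i)) = (\<Sum>l<k. if l = idx x i then g x else 0)"
        by (intro sum.cong) (auto simp: indicator_def cell_iff[OF x])
      also have "\<dots> = (if idx x i < k then g x else 0)" by (subst sum.delta) auto
      also have "idx x i < k \<longleftrightarrow> x i < real k / real M"
        unfolding idx_def using x k by (intro cell_index_less_iff) (auto simp: unit_cube_def)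
      finally show ?thesis by (simp add: indicator_def)
    qed
    have "(\<integral>x. g x * indicator {..<real k / real M} (x i) \<partial>cube_measure)
        = (\<integral>x. (\<Sum>l<k. g x * indicator (cell M l) (x i)) \<partial>cube_measure)"
      by (intro Bochner_Integration.integral_cong refl) (simp only: space_cube_measure eq)
    also have "\<dots> = (\<Sum>l<k. \<integral>x. g x * indicator (cell M l) (x i) \<partial>cube_measure)"
      by (intro Bochner_Integration.integral_sum int_mult g b) (auto simp: indicator_def)
    finally show ?thesis .
  qed
  \<comment> \<open>The average of \<open>f\<close> over the cell, since every cell has volume
    \<open>c\<close>.\<close>
  define A where "A a = (\<integral>x. f x * indicator (Q a) x \<partial>cube_measure) / c" for a
  have ind_int: "integrable cube_measure (\<lambda>x. indicator (Q a) x :: real)" for a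
    by (intro cube_integrable[where C = 1] borel_measurable_indicator Q_sets) (auto simp: indicator_def)
  have A01: "A a \<in> {0..1}" if "a \<in> grid M" for a
  proof -
    have "(\<integral>x. f x * indicator (Q a) x \<partial>cube_measure) \<le> (\<integral>x. indicator (Q a) x \<partial>cube_measure)"
      using f01 f_bound
      by (intro integral_mono int_mult ind_int) (auto simp: indicator_def space_cube_measure)
    also have "\<dots> = c" using Q_measure[OF that] sets.Int_space_eq2[OF Q_sets] by simp
    finally have "A a \<le> 1" using c by (simp add: A_def)
    moreover have "0 \<le> (\<integral>x. f x * indicator (Q a) x \<partial>cube_measure)"
      using f01 by (intro Bochner_Integration.integral_nonneg) (auto simp: indicator_def space_cube_measure)
    ultimately show ?thesis using c by (simp add: A_def)
  qed
  have A_slab: "(\<Sum>a\<in>{a\<in>grid M. a i = k}. A a) = (\<integral>t. q i t * indicator (cell M k) t \<partial>unit_measure) / c" for i k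
  proof -
    have "(\<Sum>a\<in>{a\<in>grid M. a i = k}. A a) = (\<integral>x. f x * indicator (cell M k) (x i) \<partial>cube_measure) / c"
      using slab[OF f f_bound, of k i] by (simp add: A_def sum_divide_distrib)
    also have "(\<integral>x. f x * indicator (cell M k) (x i) \<partial>cube_measure)
        = (\<integral>t. marginal f i t * indicator (cell M k) t \<partial>unit_measure)"
      using f_bound by (intro integral_marginal[where C = 1 and D = 1]) (auto simp: indicator_def)
    also have "\<dots> = (\<integral>t. q i t * indicator (cell M k) t \<partial>unit_measure)"
      using q[of i] measurable_marginal[OF f, of i] mono_on_unit_measurable[OF q_mono[of i]]
      by (intro integral_cong_AE) auto
    finally show ?thesis .
  qed
  have A_mono: "(\<Sum>a\<in>{a\<in>grid M. a i = k}. A a) \<le> (\<Sum>a\<in>{a\<in>grid M. a i = k'}. A a)" if kk': "k < k'" "k' < M" for i k k'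
  proof -
    \<comment> \<open>The left end of cell \<open>k'\<close>. It separates the two cells, so
      \<open>q i s\<close> bounds \<open>q i\<close> from above on cell \<open>k\<close> and from
      below on cell \<open>k'\<close>, and the two cells have equal length.\<close>
    define s where "s = real k' / real M"
    have s: "s \<in> {0..1}" using kk' by (simp add: s_def)
    have cs: "t < s \<longleftrightarrow> cell_index M t < k'" if "t \<in> {0..1}" for t
      unfolding s_def using cell_index_less_iff[OF kk'(2)] that by auto
    have meas [measurable]: "q i \<in> borel_measurable unit_measure"
      using q_mono by (rule mono_on_unit_measurable)
    have int: "integrable unit_measure (\<lambda>t. q i t * indicator (cell M l) t)" for l
      using q01[of _ i] by (intro unit_integrable[where C = 1]) (auto simp: indicator_def abs_le_iff intro: order_trans[of _ 0])
    have const: "(\<integral>t. q i s * indicator (cell M l) t \<partial>unit_measure) = q i s * (1 / real M)"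
      and const_int: "integrable unit_measure (\<lambda>t. q i s * indicator (cell M l) t)" if "l < M" for l
    proof -
      show "integrable unit_measure (\<lambda>t. q i s * indicator (cell M l) t)"
        by (intro integrable_mult_right integrable_real_indicator) (auto simp: less_top[symmetric])
      show "(\<integral>t. q i s * indicator (cell M l) t \<partial>unit_measure) = q i s * (1 / real M)"
        using measure_cell[OF that] sets.Int_space_eq2[OF cell_sets] by simp
    qed
    have "(\<integral>t. q i t * indicator (cell M k) t \<partial>unit_measure) \<le> (\<integral>t. q i s * indicator (cell M k) t \<partial>unit_measure)"
      using kk' s cs mono_onD[OF q_mono[of i]]
      by (intro integral_mono int const_int) (auto simp: indicator_def cell_def less_imp_le)
    also have "\<dots> = (\<integral>t. q i s * indicator (cell M k') t \<partial>unit_measure)"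
      using kk' by (simp only: const less_trans[OF kk'])
    also have "\<dots> \<le> (\<integral>t. q i t * indicator (cell M k') t \<partial>unit_measure)"
      using kk' s cs mono_onD[OF q_mono[of i]]
      by (intro integral_mono int const_int) (auto simp: indicator_def cell_def not_less[symmetric])
    finally show ?thesis
      unfolding A_slab using c by (intro divide_right_mono) auto
  qed
  have "\<exists>B. (\<forall>a\<in>grid M. B a \<in> {0..1}) \<and>
     (\<forall>i. \<forall>k<M. (\<Sum>a\<in>{a\<in>grid M. a i = k}. B a) = (\<Sum>a\<in>{a\<in>grid M. a i = k}. A a)) \<and>
     (\<forall>a\<in>grid M. \<forall>b\<in>grid M. a \<le> b \<longrightarrow> B a \<le> B b)"
    by (intro grid_monotone_rearrangement A01 A_mono)
  then obtain B where B01: "\<forall>a\<in>grid M. B a \<in> {0..1}"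
    and B_slab: "\<forall>i. \<forall>k<M. (\<Sum>a\<in>{a\<in>grid M. a i = k}. B a) = (\<Sum>a\<in>{a\<in>grid M. a i = k}. A a)"
    and B_mono: "\<forall>a\<in>grid M. \<forall>b\<in>grid M. a \<le> b \<longrightarrow> B a \<le> B b"
    by (elim exE conjE)
  define F where "F x = (\<Sum>a\<in>grid M. B a * indicator (Q a) x)" for x
  have F_eq: "F x = B (idx x)" if x: "x \<in> unit_cube" for x
  proof -
    have "F x = (\<Sum>a\<in>grid M. if a = idx x then B a else 0)"
      unfolding F_def by (intro sum.cong) (auto simp: indicator_def Q_iff[OF x])
    then show ?thesis using idx by (simp add: finite_grid)
  qed
  have F [measurable]: "F \<in> borel_measurable cube_measure"
    unfolding F_def[abs_def] by measurable
  have adm: "admissible F"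
    unfolding admissible_def
  proof (intro conjI ballI mono_onI)
    show "F x \<in> {0..1}" if "x \<in> unit_cube" for x using F_eq[OF that] B01 idx by auto
    show "F x \<le> F y" if "x \<in> unit_cube" "y \<in> unit_cube" "x \<le> y" for x y
    proof -
      have "idx x \<le> idx y"
        using that(3) by (auto simp: idx_def le_fun_def intro: cell_index_mono)
      then show ?thesis using that B_mono idx by (simp add: F_eq)
    qed
  qed (rule F)
  have FQ: "(\<integral>x. F x * indicator (Q a) x \<partial>cube_measure) = B a * c" if a: "a \<in> grid M" for a
  proof -
    have "(\<integral>x. F x * indicator (Q a) x \<partial>cube_measure) = (\<integral>x. B a * indicator (Q a) x \<partial>cube_measure)"
      using F_eq Q_iff by (intro Bochner_Integration.integral_cong) (auto simp: space_cube_measure indicator_def)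
    then show ?thesis using Q_measure[OF a] sets.Int_space_eq2[OF Q_sets] by simp
  qed
  have "(\<integral>x. F x * indicator (cell M k) (x i) \<partial>cube_measure)
      = (\<integral>x. f x * indicator (cell M k) (x i) \<partial>cube_measure)" if "k < M" for i k
  proof -
    have "(\<integral>x. F x * indicator (cell M k) (x i) \<partial>cube_measure) = (\<Sum>a\<in>{a\<in>grid M. a i = k}. B a) * c"
      using slab[OF F admissible_bounded[OF adm], of k i] FQ by (simp add: sum_distrib_right)
    also have "\<dots> = (\<Sum>a\<in>{a\<in>grid M. a i = k}. A a) * c" using B_slab that by simp
    also have "\<dots> = (\<integral>x. f x * indicator (cell M k) (x i) \<partial>cube_measure)"
      using slab[OF f f_bound, of k i] c by (simp add: A_def sum_distrib_right)
    finally show ?thesis .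
  qed
  then show ?thesis
    using adm f_bound by (intro exI[of _ F]) (auto simp: cumulative admissible_bounded intro!: sum.cong)
qed

section \<open>Recovering a left-continuous function from dyadic integrals\<close>

lemma dyadic_between:
  fixes s t :: real
  assumes "0 \<le> s" "s < t" "t \<le> 1"
  shows "\<exists>N k l. k < l \<and> l < 2 ^ N \<and> s \<le> real k / 2 ^ N \<and> real l / 2 ^ N \<le> t"
proof -
  \<comment> \<open>An interval longer than 2 / 2^N contains two consecutive multiples of 1 / 2^N.
    The surplus also keeps the upper index strictly below 2^N.\<close>
  obtain N where N: "2 / (t - s) < 2 ^ N"
    using real_arch_pow[of 2 "2 / (t - s)"] by auto
  then have gap: "2 < t * 2 ^ N - s * 2 ^ N"
    using assms by (simp add: field_simps)
  define k where "k = nat \<lceil>s * 2 ^ N\<rceil>"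
  have "0 \<le> s * 2 ^ N" using assms by simp
  then have k: "s * 2 ^ N \<le> real k" "real k < s * 2 ^ N + 1"
    unfolding k_def by linarith+
  have "t * 2 ^ N \<le> 2 ^ N" using assms by simp
  then have "real k + 1 < 2 ^ N" using k gap by linarith
  then have "real (Suc k) < 2 ^ N" by simp
  then have "Suc k < 2 ^ N" by (metis of_nat_less_iff of_nat_numeral of_nat_power)
  moreover have "s \<le> real k / 2 ^ N" "real (Suc k) / 2 ^ N \<le> t"
    using k gap by (auto simp: field_simps)
  ultimately show ?thesis by (intro exI[of _ N] exI[of _ k] exI[of _ "Suc k"]) auto
qed

lemma indicator_unit_measurable:
  "A \<in> sets borel \<Longrightarrow> (indicator A :: real \<Rightarrow> real) \<in> borel_measurable unit_measure"
  using measurable_compose[OF unit_measurable_ident borel_measurable_indicator[of A borel]] by simp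

text \<open>Between \<open>s\<close> and \<open>t\<close> lie two dyadic numbers a < b, and the
  integrals of \<open>u\<close> and \<open>v\<close> over [a,b) agree. There \<open>u\<close> is at
  least \<open>u s\<close> and \<open>v\<close> is at most \<open>v t\<close>, so the common average
  separates the two values.\<close>

lemma mono_le_of_equal_dyadic_integrals:
  fixes u v :: "real \<Rightarrow> real"
  assumes u: "mono_on {0..1} u" "\<And>t. t \<in> {0..1} \<Longrightarrow> u t \<in> {0..1}"
    and v: "mono_on {0..1} v" "\<And>t. t \<in> {0..1} \<Longrightarrow> v t \<in> {0..1}"
    and eq: "\<And>N k. k < 2 ^ N \<Longrightarrow> (\<integral>t. u t * indicator {..<real k / 2 ^ N} t \<partial>unit_measure)
      = (\<integral>t. v t * indicator {..<real k / 2 ^ N} t \<partial>unit_measure)"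
    and st: "0 \<le> s" "s < t" "t \<le> 1"
  shows "u s \<le> v t"
proof -
  obtain N k l where kl: "k < l" "l < 2 ^ N" "s \<le> real k / 2 ^ N" "real l / 2 ^ N \<le> t"
    using dyadic_between[OF st] by blast
  define a b :: real where "a = real k / 2 ^ N" and "b = real l / 2 ^ N"
  have ab: "s \<le> a" "a < b" "b \<le> t"
    using kl by (auto simp: a_def b_def divide_strict_right_mono)
  have ind_meas [measurable]: "(\<lambda>t. indicator {c..<d} t :: real) \<in> borel_measurable unit_measure"
    "(\<lambda>t. indicator {..<d} t :: real) \<in> borel_measurable unit_measure" for c d
    by (rule indicator_unit_measurable, simp)+
  have int_a: "integrable unit_measure (\<lambda>t. w t * indicator {..<d} t)"
    and int_ab: "integrable unit_measure (\<lambda>t. w t * indicator {c..<d} t)"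
    if "mono_on {0..1} w" "\<And>t. t \<in> {0..1} \<Longrightarrow> w t \<in> {0..1}" for w :: "real \<Rightarrow> real" and c d
  proof -
    have [measurable]: "w \<in> borel_measurable unit_measure" using that(1) by (rule mono_on_unit_measurable)
    have "\<bar>w t\<bar> \<le> 1" if "t \<in> {0..1}" for t using \<open>\<And>t. t \<in> {0..1} \<Longrightarrow> w t \<in> {0..1}\<close>[OF that] by auto
    then show "integrable unit_measure (\<lambda>t. w t * indicator {..<d} t)"
      "integrable unit_measure (\<lambda>t. w t * indicator {c..<d} t)"
      by (auto intro!: unit_integrable[where C = 1] simp: indicator_def)
  qed
  have diff: "(\<integral>t. w t * indicator {a..<b} t \<partial>unit_measure)
      = (\<integral>t. w t * indicator {..<b} t \<partial>unit_measure) - (\<integral>t. w t * indicator {..<a} t \<partial>unit_measure)"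
    if "mono_on {0..1} w" "\<And>t. t \<in> {0..1} \<Longrightarrow> w t \<in> {0..1}" for w :: "real \<Rightarrow> real"
  proof -
    have "(\<integral>t. w t * indicator {a..<b} t \<partial>unit_measure)
        = (\<integral>t. w t * indicator {..<b} t - w t * indicator {..<a} t \<partial>unit_measure)"
      using ab by (intro Bochner_Integration.integral_cong) (auto simp: indicator_def)
    then show ?thesis using int_a[OF that] by simp
  qed
  have const: "(\<integral>t. c * indicator {a..<b} t \<partial>unit_measure) = c * (b - a)" for c
  proof -
    have "measure unit_measure ({a..<b} \<inter> space unit_measure) = b - a"
    proof -
      have "{a..<b} \<inter> space unit_measure = {a..<b}"
        using ab st by (auto simp: space_restrict_space)
      moreover have "measure unit_measure {a..<b} = measure lebesgue {a..<b}"
        using ab st by (intro measure_restrict_space) auto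
      ultimately show ?thesis using ab by simp
    qed
    then show ?thesis by simp
  qed
  have const_int: "integrable unit_measure (\<lambda>t. c * indicator {a..<b} t)" for c :: real
    by (intro unit_integrable[where C = "\<bar>c\<bar>"]) (auto simp: indicator_def)
  have "u s * (b - a) = (\<integral>t. u s * indicator {a..<b} t \<partial>unit_measure)" by (simp only: const)
  also have "\<dots> \<le> (\<integral>t. u t * indicator {a..<b} t \<partial>unit_measure)"
    using ab st mono_onD[OF u(1), of s]
    by (intro integral_mono const_int int_ab[OF u]) (auto simp: indicator_def space_restrict_space)
  also have "\<dots> = (\<integral>t. v t * indicator {a..<b} t \<partial>unit_measure)"
    using diff[OF u] diff[OF v] eq[of k N] eq[of l N] kl by (simp add: a_def b_def)
  also have "\<dots> \<le> (\<integral>r. v t * indicator {a..<b} r \<partial>unit_measure)"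
    using ab st mono_onD[OF v(1), of _ t]
    by (intro integral_mono const_int int_ab[OF v]) (auto simp: indicator_def space_restrict_space)
  also have "\<dots> = v t * (b - a)" by (simp only: const)
  finally show ?thesis using ab by simp
qed

text \<open>The hypothesis on integrals is symmetric, so the preceding comparison applies both ways.
  It requires strictly ordered points, which is why one direction passes through the midpoint of
  \<open>s\<close> and \<open>t\<close> and then lets \<open>s\<close> tend to \<open>t\<close> from
  the left.\<close>

lemma left_continuous_eq_left_version:
  fixes u v :: "real \<Rightarrow> real"
  assumes u: "mono_on {0..1} u" "\<And>t. t \<in> {0..1} \<Longrightarrow> u t \<in> {0..1}"
    and v: "mono_on {0..1} v" "\<And>t. t \<in> {0..1} \<Longrightarrow> v t \<in> {0..1}"
    and cont: "\<And>t. t \<in> {0<..1} \<Longrightarrow> continuous (at_left t) v"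
    and eq: "\<And>N k. k < 2 ^ N \<Longrightarrow> (\<integral>t. u t * indicator {..<real k / 2 ^ N} t \<partial>unit_measure)
      = (\<integral>t. v t * indicator {..<real k / 2 ^ N} t \<partial>unit_measure)"
    and t: "t \<in> {0<..1}"
  shows "v t = left_version u t"
proof (rule antisym)
  show "left_version u t \<le> v t"
    using t mono_le_of_equal_dyadic_integrals[OF u v eq] by (intro left_version_least[OF u]) auto
  have "v s \<le> left_version u t" if "0 < s" "s < t" for s
  proof -
    have "v s \<le> u ((s + t) / 2)"
      using that t by (intro mono_le_of_equal_dyadic_integrals[OF v u eq[symmetric]]) auto
    also have "\<dots> \<le> left_version u t" using that t by (intro left_version_upper[OF u]) auto
    finally show ?thesis .
  qed
  then have "eventually (\<lambda>s. v s \<le> left_version u t) (at_left t)"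
    unfolding eventually_at_left_field using t by (intro exI[of _ 0]) auto
  moreover have "(v \<longlongrightarrow> v t) (at_left t)" using cont[OF t] by (simp add: continuous_within)
  ultimately show "v t \<le> left_version u t"
    by (intro tendsto_upperbound) auto
qed

text \<open>Convergence will be known only almost everywhere, while admissibility concerns every
  point of the cube. The limit superior exists everywhere, inherits monotonicity and measurability,
  and agrees with the limit where there is one.\<close>

lemma limsup_of_admissible:
  fixes F :: "nat \<Rightarrow> ('n::finite \<Rightarrow> real) \<Rightarrow> real"
  assumes "\<And>N. admissible (F N)"
  defines "f \<equiv> \<lambda>x. real_of_ereal (limsup (\<lambda>N. ereal (F N x)))"
  shows "admissible f" and "x \<in> unit_cube \<Longrightarrow> convergent (\<lambda>N. F N x) \<Longrightarrow> (\<lambda>N. F N x) \<longlonglongrightarrow> f x"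
proof -
  have F [measurable]: "F N \<in> borel_measurable cube_measure" and F01: "x \<in> unit_cube \<Longrightarrow> F N x \<in> {0..1}"
    and F_mono: "mono_on unit_cube (F N)" for N x
    using assms by (auto simp: admissible_def)
  let ?L = "\<lambda>x. limsup (\<lambda>N. ereal (F N x))"
  have L: "0 \<le> ?L x" "?L x \<le> 1" if "x \<in> unit_cube" for x
  proof -
    have "limsup (\<lambda>N. 0 :: ereal) \<le> ?L x" "?L x \<le> limsup (\<lambda>N. 1 :: ereal)"
      using F01[OF that] by (intro Limsup_mono always_eventually allI; simp)+
    then show "0 \<le> ?L x" "?L x \<le> 1" by (simp_all add: Limsup_const)
  qed
  show "admissible f"
    unfolding admissible_def
  proof (intro conjI ballI mono_onI)
    show "f \<in> borel_measurable cube_measure" unfolding f_def by measurable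
    show "f x \<in> {0..1}" if "x \<in> unit_cube" for x
      using L[OF that] unfolding f_def by (cases "?L x") auto
    show "f x \<le> f y" if "x \<in> unit_cube" "y \<in> unit_cube" "x \<le> y" for x y
    proof -
      have "?L x \<le> ?L y"
        using that mono_onD[OF F_mono] by (intro Limsup_mono always_eventually) auto
      then show ?thesis
        unfolding f_def using L[of x] L[of y] that by (intro real_of_ereal_positive_mono) auto
    qed
  qed
  assume "x \<in> unit_cube" "convergent (\<lambda>N. F N x)"
  then obtain l where l: "(\<lambda>N. F N x) \<longlonglongrightarrow> l" by (auto simp: convergent_def)
  then have "?L x = ereal l" by (intro lim_imp_Limsup) auto
  then show "(\<lambda>N. F N x) \<longlonglongrightarrow> f x" using l by (simp add: f_def)
qed

lemma admissible_midpoint: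
  assumes "admissible f" "admissible g"
  shows "admissible (\<lambda>x. (f x + g x) / 2)"
  unfolding admissible_def
proof (intro conjI ballI mono_onI)
  show "(\<lambda>x. (f x + g x) / 2) \<in> borel_measurable cube_measure"
    using assms by (auto simp: admissible_def)
  show "(f x + g x) / 2 \<in> {0..1}" if "x \<in> unit_cube" for x
  proof -
    have "f x \<in> {0..1}" "g x \<in> {0..1}" using assms that by (auto simp: admissible_def)
    then show ?thesis by auto
  qed
  show "(f x + g x) / 2 \<le> (f y + g y) / 2" if "x \<in> unit_cube" "y \<in> unit_cube" "x \<le> y" for x y
  proof -
    have "mono_on unit_cube f" "mono_on unit_cube g" using assms by (simp_all add: admissible_def)
    from this[THEN mono_onD, OF that] have "f x \<le> f y" "g x \<le> g y" .
    then show ?thesis by simp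
  qed
qed

text \<open>The step functions for the grids of side 2^N show that the sets \<open>K N\<close> are
  nonempty. A limit taken along them has the same integrals over {x. x i < c} as \<open>f0\<close>
  for all dyadic \<open>c\<close> in [0,1), and these integrals pin down the left versions of its
  marginals.\<close>

theorem monotone_rationalization:
  fixes q :: "'n::finite \<Rightarrow> real \<Rightarrow> real"
  assumes "q \<in> rationalizable_tuples"
  shows "\<exists>f. admissible f \<and> rationalizes f q"
proof -
  obtain f0 where q_mono: "\<And>i. mono_on {0..1} (q i)"
    and q_cont: "\<And>i t. t \<in> {0<..1} \<Longrightarrow> continuous (at_left t) (q i)"
    and q01: "\<And>i t. t \<in> {0..1} \<Longrightarrow> q i t \<in> {0..1}" and f0: "rationalizes f0 q"
    using assms unfolding rationalizable_tuples_def by blast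
  define I where "I g i c = (\<integral>x. g x * indicator {..<c} (x i) \<partial>cube_measure)"
    for g :: "('n \<Rightarrow> real) \<Rightarrow> real" and i and c :: real
  have ind_meas [measurable]: "(\<lambda>t. indicator {..<c} t :: real) \<in> borel_measurable unit_measure" for c
    by (rule indicator_unit_measurable) simp
  have int: "integrable cube_measure (\<lambda>x. g x * indicator {..<c} (x i))" if "admissible g"
    for g :: "('n \<Rightarrow> real) \<Rightarrow> real" and i c
  proof -
    have [measurable]: "g \<in> borel_measurable cube_measure" using that by (simp add: admissible_def)
    show ?thesis
      using admissible_bounded[OF that]
      by (intro cube_integrable[where C = 1]) (auto simp: indicator_def)
  qed
  \<comment> \<open>Dyadic grids are used because a threshold of level \<open>N\<close> is also a
    threshold of each later level; this makes the sets decrease.\<close>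
  define K where "K N = {g. admissible g \<and> (\<forall>i. \<forall>k<2 ^ N. I g i (real k / 2 ^ N) = I f0 i (real k / 2 ^ N))}" for N :: nat
  have K_dec: "K N' \<subseteq> K N" if "N \<le> N'" for N N'
  proof -
    have "real k / 2 ^ N = real (k * 2 ^ (N' - N)) / 2 ^ N'" "k * 2 ^ (N' - N) < 2 ^ N'" if "k < 2 ^ N" for k
    proof -
      have "(2::real) ^ N' = 2 ^ N * 2 ^ (N' - N)" "(2::nat) ^ N' = 2 ^ N * 2 ^ (N' - N)"
        using \<open>N \<le> N'\<close> by (simp_all flip: power_add)
      then show "real k / 2 ^ N = real (k * 2 ^ (N' - N)) / 2 ^ N'" "k * 2 ^ (N' - N) < 2 ^ N'"
        using that by simp_all
    qed
    then show ?thesis unfolding K_def by fastforce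
  qed
  have "\<exists>F. (\<forall>N. F N \<in> K N) \<and> (AE x in cube_measure. convergent (\<lambda>N. F N x))"
  proof (rule cube.convex_chain_AE_convergent)
    show "K N' \<subseteq> K N" if "N \<le> N'" for N N' using that by (rule K_dec)
  next
    fix N :: nat
    show "K N \<noteq> {}"
      using grid_approximation[OF f0 q_mono q01, of "2 ^ N"] by (auto simp: K_def I_def)
  next
    fix N f g assume "f \<in> K N" "g \<in> K N"
    then have fg: "admissible f" "admissible g"
      "\<And>i k. k < 2 ^ N \<Longrightarrow> I f i (real k / 2 ^ N) = I f0 i (real k / 2 ^ N)"
      "\<And>i k. k < 2 ^ N \<Longrightarrow> I g i (real k / 2 ^ N) = I f0 i (real k / 2 ^ N)" by (auto simp: K_def)
    have mid: "I (\<lambda>x. (f x + g x) / 2) i c = (I f i c + I g i c) / 2" for i c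
    proof -
      have "I (\<lambda>x. (f x + g x) / 2) i c
          = (\<integral>x. (f x * indicator {..<c} (x i) + g x * indicator {..<c} (x i)) / 2 \<partial>cube_measure)"
        unfolding I_def by (intro Bochner_Integration.integral_cong) (auto simp: algebra_simps add_divide_distrib)
      then show ?thesis using int[OF fg(1)] int[OF fg(2)] by (simp add: I_def)
    qed
    show "(\<lambda>x. (f x + g x) / 2) \<in> K N"
      using fg(3,4) admissible_midpoint[OF fg(1,2)] by (simp add: K_def mid)
  qed (auto simp: K_def admissible_def space_cube_measure)
  then obtain F where F: "\<And>N. F N \<in> K N" and conv: "AE x in cube_measure. convergent (\<lambda>N. F N x)"
    by blast
  have adm: "admissible (F N)" for N using F[of N] by (simp add: K_def)
  define f where "f = (\<lambda>x. real_of_ereal (limsup (\<lambda>N. ereal (F N x))))"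
  have f: "admissible f" unfolding f_def by (rule limsup_of_admissible(1)[OF adm])
  have lim: "AE x in cube_measure. (\<lambda>N. F N x) \<longlonglongrightarrow> f x"
    using conv by (rule AE_mp) (auto intro!: AE_I2 limsup_of_admissible(2)[OF adm] simp: f_def space_cube_measure)
  \<comment> \<open>The integrals of \<open>F n\<close> at a threshold of level \<open>N\<close> are
    correct from \<open>n = N\<close> on, so their sequence is eventually constant.\<close>
  have I_eq: "I f i (real k / 2 ^ N) = I f0 i (real k / 2 ^ N)" if "k < 2 ^ N" for i k N
  proof (rule LIMSEQ_unique)
    have "F n \<in> K N" if "n \<ge> N" for n using F[of n] K_dec[OF that] by blast
    then have "eventually (\<lambda>n. I f0 i (real k / 2 ^ N) = I (F n) i (real k / 2 ^ N)) sequentially"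
      using \<open>k < 2 ^ N\<close> by (auto simp: K_def eventually_sequentially intro!: exI[of _ N])
    then show "(\<lambda>n. I (F n) i (real k / 2 ^ N)) \<longlonglongrightarrow> I f0 i (real k / 2 ^ N)"
      by (rule Lim_transform_eventually[OF tendsto_const])
    show "(\<lambda>n. I (F n) i (real k / 2 ^ N)) \<longlonglongrightarrow> I f i (real k / 2 ^ N)"
      unfolding I_def
    proof (rule integral_dominated_convergence[where w = "\<lambda>_. 1"])
      show "AE x in cube_measure. (\<lambda>n. F n x * indicator {..<real k / 2 ^ N} (x i)) \<longlonglongrightarrow> f x * indicator {..<real k / 2 ^ N} (x i)"
        using lim by (rule AE_mp) (auto intro!: AE_I2 tendsto_mult_right)
      show "AE x in cube_measure. norm (F n x * indicator {..<real k / 2 ^ N} (x i)) \<le> 1" for n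
        using admissible_bounded[OF adm] by (intro AE_I2) (auto simp: indicator_def space_cube_measure)
    qed (use int[OF f] int[OF adm] in auto)
  qed
  have "q i t = left_version (marginal f i) t" if "t \<in> {0<..1}" for i t
  proof (rule left_continuous_eq_left_version[OF admissible_marginal[OF f] q_mono q01 q_cont _ that])
    fix N k :: nat assume k: "k < 2 ^ N"
    have I_marginal: "I g i c = (\<integral>t. marginal g i t * indicator {..<c} t \<partial>unit_measure)"
      if "g \<in> borel_measurable cube_measure" "\<And>x. x \<in> unit_cube \<Longrightarrow> g x \<in> {0..1}" for g c
    proof -
      have "\<bar>g x\<bar> \<le> 1" if "x \<in> unit_cube" for x
        using \<open>\<And>x. x \<in> unit_cube \<Longrightarrow> g x \<in> {0..1}\<close>[OF that] by auto
      then show ?thesis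
        unfolding I_def using that(1) by (intro integral_marginal[where C = 1 and D = 1]) (auto simp: indicator_def)
    qed
    have "(\<integral>t. marginal f i t * indicator {..<real k / 2 ^ N} t \<partial>unit_measure) = I f i (real k / 2 ^ N)"
      using f by (intro I_marginal[symmetric]) (auto simp: admissible_def)
    also have "\<dots> = I f0 i (real k / 2 ^ N)" by (rule I_eq[OF k])
    also have "\<dots> = (\<integral>t. marginal f0 i t * indicator {..<real k / 2 ^ N} t \<partial>unit_measure)"
      using f0 by (intro I_marginal) (auto simp: rationalizes_iff)
    also have "\<dots> = (\<integral>t. q i t * indicator {..<real k / 2 ^ N} t \<partial>unit_measure)"
    proof (rule integral_cong_AE)
      have "AE t in unit_measure. q i t = marginal f0 i t" using f0 by (simp add: rationalizes_iff)
      then show "AE t in unit_measure. marginal f0 i t * indicator {..<real k / 2 ^ N} t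
          = q i t * indicator {..<real k / 2 ^ N} t"
        by eventually_elim simp
    qed (use f0 measurable_marginal[of f0 i] mono_on_unit_measurable[OF q_mono[of i]] in
        \<open>auto simp: rationalizes_iff\<close>)
    finally show "(\<integral>t. marginal f i t * indicator {..<real k / 2 ^ N} t \<partial>unit_measure)
        = (\<integral>t. q i t * indicator {..<real k / 2 ^ N} t \<partial>unit_measure)" .
  qed
  note q_eq = this
  have "AE t in unit_measure. t \<in> {0<..1}"
    by (subst AE_restrict_space_iff) (auto intro!: AE_I'[of "{0}"])
  moreover have "AE t in unit_measure. left_version (marginal f i) t = marginal f i t" for i
    by (intro left_version_AE admissible_marginal[OF f])
  ultimately have "AE t in unit_measure. q i t = marginal f i t" for i
    by eventually_elim (simp add: q_eq)
  then have "rationalizes f q" using f by (auto simp: rationalizes_iff admissible_def)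
  then show ?thesis using f by blast
qed

section \<open>Perturbation of a rationalization of an extreme point\<close>

text \<open>Differences of admissible functions may be negative. Boundedness on the cube makes all
  slices integrable, and marginals are then additive.\<close>

definition bounded_measurable :: "(('n::finite \<Rightarrow> real) \<Rightarrow> real) \<Rightarrow> bool" where
  "bounded_measurable h \<longleftrightarrow> h \<in> borel_measurable cube_measure \<and> (\<exists>C. \<forall>x\<in>unit_cube. \<bar>h x\<bar> \<le> C)"

lemma bounded_measurableI:
  "h \<in> borel_measurable cube_measure \<Longrightarrow> (\<And>x. x \<in> unit_cube \<Longrightarrow> \<bar>h x\<bar> \<le> C) \<Longrightarrow> bounded_measurable h"
  by (auto simp: bounded_measurable_def)

lemma admissible_bounded_measurable: "admissible f \<Longrightarrow> bounded_measurable f"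
  by (rule bounded_measurableI[where C = 1]) (auto simp: admissible_bounded admissible_def)

lemma bounded_measurable_slice_integrable:
  "bounded_measurable h \<Longrightarrow> t \<in> {0..1} \<Longrightarrow>
    integrable (\<Pi>\<^sub>M k\<in>UNIV - {i}. unit_measure) (\<lambda>y. h (y(i := t)))"
  unfolding bounded_measurable_def using slice_integrable[of h] by blast

lemma bounded_measurable_cmult:
  assumes "bounded_measurable h"
  shows "bounded_measurable (\<lambda>x. c * h x)"
proof -
  from assms obtain C where "h \<in> borel_measurable cube_measure" "\<And>x. x \<in> unit_cube \<Longrightarrow> \<bar>h x\<bar> \<le> C"
    by (auto simp: bounded_measurable_def)
  then show ?thesis
    by (intro bounded_measurableI[where C = "\<bar>c\<bar> * C"]) (auto simp: abs_mult mult_left_mono)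
qed

lemma bounded_measurable_add:
  assumes "bounded_measurable h" "bounded_measurable g"
  shows "bounded_measurable (\<lambda>x. h x + g x)"
proof -
  from assms obtain C D where C: "h \<in> borel_measurable cube_measure" "\<And>x. x \<in> unit_cube \<Longrightarrow> \<bar>h x\<bar> \<le> C"
    and D: "g \<in> borel_measurable cube_measure" "\<And>x. x \<in> unit_cube \<Longrightarrow> \<bar>g x\<bar> \<le> D"
    by (auto simp: bounded_measurable_def)
  show ?thesis
  proof (rule bounded_measurableI[where C = "C + D"])
    show "\<bar>h x + g x\<bar> \<le> C + D" if "x \<in> unit_cube" for x
      using abs_triangle_ineq[of "h x" "g x"] C(2)[OF that] D(2)[OF that] by linarith
  qed (use C(1) D(1) in simp)
qed

lemma bounded_measurable_diff:
  "bounded_measurable h \<Longrightarrow> bounded_measurable g \<Longrightarrow> bounded_measurable (\<lambda>x. h x - g x)"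
  using bounded_measurable_add[of h "\<lambda>x. -1 * g x"] bounded_measurable_cmult[of g "-1"] by simp

lemma bounded_measurable_sum:
  "(\<And>k. k \<in> S \<Longrightarrow> bounded_measurable (g k)) \<Longrightarrow> bounded_measurable (\<lambda>x. \<Sum>k\<in>S. g k x)"
  by (induction S rule: infinite_finite_induct)
     (auto intro: bounded_measurable_add bounded_measurableI[where C = 0])

lemma marginal_linear:
  assumes "bounded_measurable h" "bounded_measurable g" "t \<in> {0..1}"
  shows "marginal (\<lambda>x. h x + g x) i t = marginal h i t + marginal g i t"
    and "marginal (\<lambda>x. h x - g x) i t = marginal h i t - marginal g i t"
  unfolding marginal_def
  using bounded_measurable_slice_integrable[OF assms(1,3)] bounded_measurable_slice_integrable[OF assms(2,3)]
  by simp_all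

lemma marginal_cong:
  "(\<And>x. x \<in> unit_cube \<Longrightarrow> f x = g x) \<Longrightarrow> t \<in> {0..1} \<Longrightarrow> marginal f i t = marginal g i t"
  unfolding marginal_def by (intro Bochner_Integration.integral_cong) (auto simp: fun_upd_in_unit_cube)

text \<open>The left-hand side of the \<open>j\<close>-th constraint, regarded as a functional of
  the rationalizing function; there it is linear, so the value of a mixture is the mixture of the
  values.\<close>

definition moment :: "('n::finite \<Rightarrow> nat \<Rightarrow> real \<Rightarrow> real) \<Rightarrow> nat \<Rightarrow> (('n \<Rightarrow> real) \<Rightarrow> real) \<Rightarrow> real" where
  "moment \<psi> j h = (\<Sum>i\<in>UNIV. \<integral>t. marginal h i t * \<psi> i j t \<partial>unit_measure)"

lemma ess_bounded_integrable:
  assumes "ess_bounded g"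
  shows "integrable unit_measure g"
proof -
  from assms obtain C where "g \<in> borel_measurable unit_measure" "AE t in unit_measure. \<bar>g t\<bar> \<le> C"
    by (auto simp: ess_bounded_def)
  then show ?thesis by (intro unit.integrable_const_bound[where B = C]) auto
qed

lemma marginal_times_integrable:
  assumes "bounded_measurable h" "integrable unit_measure g"
  shows "integrable unit_measure (\<lambda>t. marginal h i t * g t)"
proof -
  from assms(1) obtain C where h: "h \<in> borel_measurable cube_measure"
    and C: "\<And>x. x \<in> unit_cube \<Longrightarrow> \<bar>h x\<bar> \<le> C"
    by (auto simp: bounded_measurable_def)
  have "\<bar>marginal h i t\<bar> \<le> \<bar>C\<bar>" if "t \<in> {0..1}" for t
  proof -
    have bounds: "h x \<le> C" "- C \<le> h x" if "x \<in> unit_cube" for x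
      using C[OF that] by linarith+
    have "marginal h i t \<le> marginal (\<lambda>_. C) i t"
      by (rule marginal_mono[OF h C _ order_refl that that]) (simp_all add: bounds)
    moreover have "marginal (\<lambda>_. - C) i t \<le> marginal h i t"
      by (rule marginal_mono[OF _ order_refl h C that that]) (simp_all add: bounds)
    ultimately have "marginal h i t \<le> C" "- C \<le> marginal h i t" by simp_all
    then show ?thesis by linarith
  qed
  then have AE: "AE t in unit_measure. norm (marginal h i t * g t) \<le> norm (C * g t)"
    by (intro AE_I2) (simp add: space_restrict_space abs_mult mult_right_mono)
  have "(\<lambda>t. marginal h i t * g t) \<in> borel_measurable unit_measure"
    using assms(2) measurable_marginal[OF h, of i] by (intro borel_measurable_times) auto
  from Bochner_Integration.integrable_bound[OF integrable_mult_right[OF assms(2)] this AE]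
  show ?thesis .
qed

context
  fixes \<psi> :: "'n::finite \<Rightarrow> nat \<Rightarrow> real \<Rightarrow> real" and \<eta> :: "nat \<Rightarrow> real" and m :: nat
  assumes \<psi>: "\<And>i j. j \<in> {1..m} \<Longrightarrow> ess_bounded (\<psi> i j)"
begin

lemma moment_linear:
  assumes "j \<in> {1..m}" "bounded_measurable h" "bounded_measurable g"
  shows "moment \<psi> j (\<lambda>x. h x + g x) = moment \<psi> j h + moment \<psi> j g"
    and "moment \<psi> j (\<lambda>x. h x - g x) = moment \<psi> j h - moment \<psi> j g"
proof -
  note int = marginal_times_integrable[OF assms(2) ess_bounded_integrable[OF \<psi>[OF assms(1)]]]
    marginal_times_integrable[OF assms(3) ess_bounded_integrable[OF \<psi>[OF assms(1)]]]
  have "(\<integral>t. marginal (\<lambda>x. h x + g x) i t * \<psi> i j t \<partial>unit_measure)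
      = (\<integral>t. marginal h i t * \<psi> i j t + marginal g i t * \<psi> i j t \<partial>unit_measure)" for i
    by (intro Bochner_Integration.integral_cong refl)
      (simp add: space_restrict_space marginal_linear(1)[OF assms(2,3)] distrib_right)
  then show "moment \<psi> j (\<lambda>x. h x + g x) = moment \<psi> j h + moment \<psi> j g"
    using int by (simp add: moment_def sum.distrib)
  have "(\<integral>t. marginal (\<lambda>x. h x - g x) i t * \<psi> i j t \<partial>unit_measure)
      = (\<integral>t. marginal h i t * \<psi> i j t - marginal g i t * \<psi> i j t \<partial>unit_measure)" for i
    by (intro Bochner_Integration.integral_cong refl)
      (simp add: space_restrict_space marginal_linear(2)[OF assms(2,3)] left_diff_distrib)
  then show "moment \<psi> j (\<lambda>x. h x - g x) = moment \<psi> j h - moment \<psi> j g"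
    using int by (simp add: moment_def sum_subtractf)
qed

lemma moment_cmult: "moment \<psi> j (\<lambda>x. c * h x) = c * moment \<psi> j h"
  by (simp add: moment_def marginal_cmult sum_distrib_left mult.assoc)

lemma moment_cong: "(\<And>x. x \<in> unit_cube \<Longrightarrow> f x = g x) \<Longrightarrow> moment \<psi> j f = moment \<psi> j g"
  unfolding moment_def using marginal_cong[of f g]
  by (intro sum.cong Bochner_Integration.integral_cong) (auto simp: space_restrict_space)

lemma moment_sum:
  assumes "j \<in> {1..m}" "\<And>k. k \<in> S \<Longrightarrow> bounded_measurable (g k)"
  shows "moment \<psi> j (\<lambda>x. \<Sum>k\<in>S. w k * g k x) = (\<Sum>k\<in>S. w k * moment \<psi> j (g k))"
  using assms(2)
proof (induction S rule: infinite_finite_induct)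
  case (insert k S)
  then show ?case
    using moment_linear(1)[OF assms(1), of "\<lambda>x. w k * g k x" "\<lambda>x. \<Sum>k\<in>S. w k * g k x"]
    by (simp add: moment_cmult bounded_measurable_sum bounded_measurable_cmult)
qed (simp_all add: moment_def)

lemma moment_left_marginals:
  assumes "j \<in> {1..m}" "admissible f"
  shows "(\<Sum>i\<in>UNIV. \<integral>t. left_version (marginal f i) t * \<psi> i j t \<partial>unit_measure) = moment \<psi> j f"
  unfolding moment_def
proof (intro sum.cong refl integral_cong_AE)
  fix i
  note m = admissible_marginal[OF assms(2), where i = i]
  have "\<psi> i j \<in> borel_measurable unit_measure" using \<psi>[OF assms(1)] by (auto simp: ess_bounded_def)
  then show "(\<lambda>t. left_version (marginal f i) t * \<psi> i j t) \<in> borel_measurable unit_measure"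
    "(\<lambda>t. marginal f i t * \<psi> i j t) \<in> borel_measurable unit_measure"
    using mono_on_unit_measurable[OF left_version_mono[OF m]] mono_on_unit_measurable[OF m(1)] by auto
  show "AE t in unit_measure. left_version (marginal f i) t * \<psi> i j t = marginal f i t * \<psi> i j t"
    using left_version_AE[OF m] by (rule AE_mp) auto
qed

lemma moment_rationalized:
  assumes "j \<in> {1..m}" "admissible f" "rationalizes f q" "q \<in> rationalizable_tuples"
  shows "(\<Sum>i\<in>UNIV. \<integral>t. q i t * \<psi> i j t \<partial>unit_measure) = moment \<psi> j f"
  unfolding moment_def
proof (intro sum.cong refl integral_cong_AE)
  fix i
  have "\<psi> i j \<in> borel_measurable unit_measure" using \<psi>[OF assms(1)] by (auto simp: ess_bounded_def)
  moreover have "q i \<in> borel_measurable unit_measure"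
    using assms(4) by (intro mono_on_unit_measurable) (simp add: rationalizable_tuples_def)
  ultimately show "(\<lambda>t. q i t * \<psi> i j t) \<in> borel_measurable unit_measure"
    "(\<lambda>t. marginal f i t * \<psi> i j t) \<in> borel_measurable unit_measure"
    using mono_on_unit_measurable[OF admissible_marginal(1)[OF assms(2)]] by auto
  show "AE t in unit_measure. q i t * \<psi> i j t = marginal f i t * \<psi> i j t"
    using assms(3) by (auto simp: rationalizes_iff)
qed

text \<open>If \<open>f\<close> can be moved both towards and away from \<open>g\<close>, then \<open>q\<close> is the midpoint of the
  marginals of the two perturbations, so extremality forces \<open>f\<close> and \<open>g\<close> to have equal marginals.\<close>

lemma extreme_point_replacement:
  assumes ext: "q ae_extreme_point_of constrained_tuples m \<psi> \<eta>"
    and f: "admissible f" "rationalizes f q"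
    and g: "g \<in> borel_measurable cube_measure" "\<And>x. x \<in> unit_cube \<Longrightarrow> g x \<in> {0..1}"
    and moments: "\<And>j. j \<in> {1..m} \<Longrightarrow> moment \<psi> j g = moment \<psi> j f"
    and "\<epsilon> > 0" and plus: "admissible (\<lambda>x. f x + \<epsilon> * (g x - f x))"
    and minus: "admissible (\<lambda>x. f x - \<epsilon> * (g x - f x))"
  shows "rationalizes g q"
proof -
  have q: "q \<in> constrained_tuples m \<psi> \<eta>" using ext by (simp add: ae_extreme_point_of_def)
  then have qQ: "q \<in> rationalizable_tuples" by (simp add: constrained_tuples_def)
  have bm_f: "bounded_measurable f" using f(1) by (rule admissible_bounded_measurable)
  have "\<bar>g x\<bar> \<le> 1" if "x \<in> unit_cube" for x using g(2)[OF that] by auto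
  then have bm_g: "bounded_measurable g" by (rule bounded_measurableI[OF g(1)])
  define h where "h x = \<epsilon> * (g x - f x)" for x
  have bm_h: "bounded_measurable h"
    unfolding h_def by (intro bounded_measurable_cmult bounded_measurable_diff bm_f bm_g)
  \<comment> \<open>Equality of the moments means that the perturbation leaves every constraint
    value unchanged, so both perturbed tuples stay feasible even where a constraint binds.\<close>
  have h0: "moment \<psi> j h = 0" if "j \<in> {1..m}" for j
    unfolding h_def moment_cmult moment_linear(2)[OF that bm_g bm_f] using moments[OF that] by simp
  \<comment> \<open>Left versions are needed for membership in the constrained set; they alter the
    marginals only on null sets.\<close>
  define a where "a i = left_version (marginal (\<lambda>x. f x - h x) i)" for i
  define b where "b i = left_version (marginal (\<lambda>x. f x + h x) i)" for i
  have plus: "admissible (\<lambda>x. f x + h x)" and minus: "admissible (\<lambda>x. f x - h x)"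
    unfolding h_def by (rule plus, rule minus)
  have ab_Q: "a \<in> rationalizable_tuples" "b \<in> rationalizable_tuples"
    unfolding a_def[abs_def] b_def[abs_def] by (rule left_marginals_rationalized plus minus)+
  have q_moment: "moment \<psi> j f \<le> \<eta> j" if "j \<in> {1..m}" for j
  proof -
    have "\<forall>j\<in>{1..m}. (\<Sum>i\<in>UNIV. \<integral>t. q i t * \<psi> i j t \<partial>unit_measure) \<le> \<eta> j"
      using q by (simp add: constrained_tuples_def)
    from bspec[OF this that] show ?thesis by (simp only: moment_rationalized[OF that f qQ])
  qed
  have "(\<Sum>i\<in>UNIV. \<integral>t. a i t * \<psi> i j t \<partial>unit_measure) \<le> \<eta> j"
    "(\<Sum>i\<in>UNIV. \<integral>t. b i t * \<psi> i j t \<partial>unit_measure) \<le> \<eta> j" if "j \<in> {1..m}" for j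
    unfolding a_def b_def moment_left_marginals[OF that plus] moment_left_marginals[OF that minus]
      moment_linear[OF that bm_f bm_h] h0[OF that] using q_moment[OF that] by simp_all
  then have ab: "a \<in> constrained_tuples m \<psi> \<eta>" "b \<in> constrained_tuples m \<psi> \<eta>"
    using ab_Q by (simp_all add: constrained_tuples_def)
  have ab_AE: "AE t in unit_measure. t \<in> {0..1} \<and> q i t = marginal f i t \<and>
      a i t = marginal f i t - marginal h i t \<and> b i t = marginal f i t + marginal h i t" for i
  proof -
    have "AE t in unit_measure. t \<in> {0..1}" by (intro AE_I2) (simp add: space_restrict_space)
    moreover have "AE t in unit_measure. q i t = marginal f i t" using f(2) by (simp add: rationalizes_iff)
    moreover have "AE t in unit_measure. a i t = marginal (\<lambda>x. f x - h x) i t"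
      unfolding a_def by (intro left_version_AE admissible_marginal[OF minus])
    moreover have "AE t in unit_measure. b i t = marginal (\<lambda>x. f x + h x) i t"
      unfolding b_def by (intro left_version_AE admissible_marginal[OF plus])
    ultimately show ?thesis
      by eventually_elim (simp add: marginal_linear[OF bm_f bm_h])
  qed
  have "ae_eq q (\<lambda>i t. (1 - 1 / 2) * a i t + 1 / 2 * b i t)"
    unfolding ae_eq_def
  proof
    fix i show "AE t in unit_measure. q i t = (1 - 1 / 2) * a i t + 1 / 2 * b i t"
      using ab_AE[of i] by eventually_elim (simp add: field_simps)
  qed
  moreover have "(0::real) < 1 / 2" "(1 / 2::real) < 1" by auto
  ultimately have "ae_eq a b"
    using ext ab unfolding ae_extreme_point_of_def by blast
  then have "AE t in unit_measure. q i t = marginal g i t" for i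
    unfolding ae_eq_def
  proof (elim allE[of _ i])
    assume "AE t in unit_measure. a i t = b i t"
    with ab_AE[of i] show ?thesis
    proof eventually_elim
      case (elim t)
      then have "marginal h i t = \<epsilon> * (marginal g i t - marginal f i t)"
        unfolding h_def marginal_cmult using marginal_linear(2)[OF bm_g bm_f, of t i] by simp
      moreover have "marginal h i t = 0" using elim by linarith
      ultimately show ?case using elim \<open>\<epsilon> > 0\<close> by simp
    qed
  qed
  then show ?thesis using g by (simp add: rationalizes_iff)
qed

end

section \<open>Reduction to nested up-sets\<close>

lemma admissible_compose:
  assumes f: "admissible f" and meas: "(\<lambda>x. A (f x)) \<in> borel_measurable cube_measure"
    and mono: "\<And>y y'. 0 \<le> y \<Longrightarrow> y \<le> y' \<Longrightarrow> y' \<le> 1 \<Longrightarrow> A y \<le> A y'" and "A 0 = 0" "A 1 = 1"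
  shows "admissible (\<lambda>x. A (f x))"
  unfolding admissible_def
proof (intro conjI ballI mono_onI)
  have f01: "0 \<le> f x" "f x \<le> 1" if "x \<in> unit_cube" for x using f that by (auto simp: admissible_def)
  show "A (f x) \<in> {0..1}" if "x \<in> unit_cube" for x
    using mono[of 0 "f x"] mono[of "f x" 1] f01[OF that] \<open>A 0 = 0\<close> \<open>A 1 = 1\<close> by simp
  show "A (f x) \<le> A (f y)" if "x \<in> unit_cube" "y \<in> unit_cube" "x \<le> y" for x y
  proof -
    have "mono_on unit_cube f" using f by (simp add: admissible_def)
    from mono_onD[OF this that] show ?thesis using f01 that by (intro mono) auto
  qed
qed (rule meas)

lemma admissible_mixture:
  assumes "finite K" "\<And>k. k \<in> K \<Longrightarrow> 0 \<le> w k" "sum w K = 1"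
    and U: "\<And>k. k \<in> K \<Longrightarrow> U k \<in> sets cube_measure" "\<And>k. k \<in> K \<Longrightarrow> up_set (U k)"
  shows "admissible (\<lambda>x. \<Sum>k\<in>K. w k * indicator (U k) x)"
  unfolding admissible_def
proof (intro conjI ballI mono_onI)
  show "(\<lambda>x. \<Sum>k\<in>K. w k * indicator (U k) x) \<in> borel_measurable cube_measure"
    using U(1) by (intro borel_measurable_sum borel_measurable_times borel_measurable_const) auto
  show "(\<Sum>k\<in>K. w k * indicator (U k) x) \<in> {0..1}" for x
  proof -
    have "(\<Sum>k\<in>K. w k * indicator (U k) x) \<le> sum w K"
      using assms(2) by (intro sum_mono) (auto simp: indicator_def)
    moreover have "0 \<le> (\<Sum>k\<in>K. w k * indicator (U k) x)"
      using assms(2) by (intro sum_nonneg) (auto simp: indicator_def)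
    ultimately show ?thesis using assms(3) by simp
  qed
  show "(\<Sum>k\<in>K. w k * indicator (U k) x) \<le> (\<Sum>k\<in>K. w k * indicator (U k) y)"
    if "x \<in> unit_cube" "y \<in> unit_cube" "x \<le> y" for x y
  proof (intro sum_mono mult_left_mono assms(2))
    fix k assume "k \<in> K"
    then show "indicator (U k) x \<le> (indicator (U k) y :: real)"
      using U(2)[of k] that by (auto simp: up_set_def indicator_def)
  qed
qed

text \<open>The \<open>N\<close> ramps of slope \<open>N\<close> average to the identity on \<open>[0,1]\<close>, and each of them approximates
  the indicator function of a half-line.\<close>

definition ramp :: "nat \<Rightarrow> nat \<Rightarrow> real \<Rightarrow> real" where
  "ramp N k y = max 0 (min 1 (real N * y - real k))"

lemma ramp_range: "0 \<le> ramp N k y" "ramp N k y \<le> 1"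
  by (auto simp: ramp_def)

lemma ramp_0: "ramp N k 0 = 0"
  by (simp add: ramp_def)

lemma ramp_1: "k < N \<Longrightarrow> ramp N k 1 = 1"
  by (simp add: ramp_def)

lemma ramp_mono: "y \<le> y' \<Longrightarrow> ramp N k y \<le> ramp N k y'"
  unfolding ramp_def by (intro max.mono min.mono diff_mono mult_left_mono) auto

lemma ramp_lipschitz: "y \<le> y' \<Longrightarrow> ramp N k y' - ramp N k y \<le> real N * (y' - y)"
proof -
  assume "y \<le> y'"
  then have "real N * y \<le> real N * y'" by (intro mult_left_mono) auto
  then show ?thesis by (auto simp: ramp_def right_diff_distrib max_def min_def)
qed

lemma sum_ramp:
  assumes "0 \<le> y" "y \<le> 1"
  shows "(\<Sum>k<N. ramp N k y) = real N * y"
proof -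
  have "(\<Sum>k<n. max 0 (min 1 (z - real k))) = min (real n) z" if "0 \<le> z" for n and z :: real
    using that by (induction n) (auto simp: min_def max_def)
  from this[of "real N * y" N] show ?thesis using assms by (simp add: ramp_def mult_left_le)
qed

text \<open>\<open>ramp N k\<close> rises from 0 at k/N to 1 at (k+1)/N, and both ends tend to
  \<open>s\<close>. At \<open>y = s\<close> the limit depends on how k/N approaches
  \<open>s\<close>, so nothing is claimed there.\<close>

lemma ramp_limit:
  assumes N: "filterlim N at_top sequentially" and lim: "(\<lambda>n. real (k n) / real (N n)) \<longlonglongrightarrow> s"
  shows "s < y \<Longrightarrow> (\<lambda>n. ramp (N n) (k n) y) \<longlonglongrightarrow> 1" and "y < s \<Longrightarrow> (\<lambda>n. ramp (N n) (k n) y) \<longlonglongrightarrow> 0"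
proof -
  have N_pos: "eventually (\<lambda>n. 0 < N n) sequentially"
    using N[unfolded filterlim_at_top, THEN spec, of 1] by eventually_elim simp
  show "(\<lambda>n. ramp (N n) (k n) y) \<longlonglongrightarrow> 1" if "s < y"
  proof -
    \<comment> \<open>One half of the gap absorbs the error of k/N against \<open>s\<close>; the
      other half eventually exceeds the width 1/N of the ramp.\<close>
    define \<delta> where "\<delta> = (y - s) / 2"
    have \<delta>: "0 < \<delta>" "s < y - \<delta>" using that by (auto simp: \<delta>_def field_simps)
    obtain n0 :: nat where n0: "1 / \<delta> < n0" using reals_Archimedean2 by blast
    have "eventually (\<lambda>n. n0 \<le> N n) sequentially" using N by (simp add: filterlim_at_top)
    moreover have "eventually (\<lambda>n. real (k n) / real (N n) < y - \<delta>) sequentially"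
      using order_tendstoD(2)[OF lim \<delta>(2)] .
    ultimately have "eventually (\<lambda>n. ramp (N n) (k n) y = 1) sequentially"
      using N_pos
    proof eventually_elim
      case (elim n)
      have "1 < \<delta> * real n0" using n0 \<delta> by (simp add: field_simps)
      also have "\<dots> \<le> \<delta> * real (N n)" using elim \<delta> by simp
      finally have "1 < real (N n) * \<delta>" by (simp add: mult.commute)
      moreover have "real (k n) < real (N n) * y - real (N n) * \<delta>"
        using elim by (simp add: field_simps)
      ultimately have "1 \<le> real (N n) * y - real (k n)" by linarith
      then show ?case by (simp add: ramp_def)
    qed
    then show ?thesis by (rule tendsto_eventually)
  qed
  show "(\<lambda>n. ramp (N n) (k n) y) \<longlonglongrightarrow> 0" if "y < s"
  proof -
    have "eventually (\<lambda>n. ramp (N n) (k n) y = 0) sequentially"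
      using order_tendstoD(1)[OF lim that] N_pos
    proof eventually_elim
      case (elim n)
      then have "real (N n) * y - real (k n) \<le> 0" by (simp add: field_simps)
      then show ?case by (simp add: ramp_def)
    qed
    then show ?thesis by (rule tendsto_eventually)
  qed
qed

section \<open>Mixtures of ramps and level sets for an extreme point\<close>

context
  fixes \<psi> :: "'n::finite \<Rightarrow> nat \<Rightarrow> real \<Rightarrow> real" and \<eta> :: "nat \<Rightarrow> real" and m :: nat
    and q :: "'n \<Rightarrow> real \<Rightarrow> real"
  assumes \<psi>: "\<And>i j. j \<in> {1..m} \<Longrightarrow> ess_bounded (\<psi> i j)"
    and ext: "q ae_extreme_point_of constrained_tuples m \<psi> \<eta>"
begin

text \<open>On the cube \<open>f\<close> is the average of its \<open>N\<close> ramps, and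
  Caratheodory keeps \<open>m + 1\<close> of them without changing the moments. The resulting
  \<open>g\<close> fixes 0 and 1, is nondecreasing and has Lipschitz constant \<open>N\<close>, so
  \<open>f\<close> can be moved towards \<open>g (f x)\<close> and away from it.\<close>

lemma ramp_rationalization:
  assumes f: "admissible f" "rationalizes f q" and N: "N > 0"
  shows "\<exists>\<kappa> \<omega>. (\<forall>j\<in>{1..m + 1}. \<kappa> j < N \<and> \<omega> j \<in> {0..1}) \<and> (\<Sum>j = 1..m + 1. \<omega> j) = 1 \<and>
    rationalizes (\<lambda>x. \<Sum>j = 1..m + 1. \<omega> j * ramp N (\<kappa> j) (f x)) q"
proof -
  have f01: "0 \<le> f x" "f x \<le> 1" if "x \<in> unit_cube" for x using f that by (auto simp: admissible_def)
  have f_meas [measurable]: "f \<in> borel_measurable cube_measure" using f by (simp add: admissible_def)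
  have ramp_bm: "bounded_measurable (\<lambda>x. ramp N k (f x))" for k
    using ramp_range by (intro bounded_measurableI[where C = 1]) (auto simp: ramp_def[abs_def])
  define v where "v j k = moment \<psi> j (\<lambda>x. ramp N k (f x))" for j k
  obtain S w where S: "S \<subseteq> {..<N}" "card S \<le> m + 1" "\<forall>k\<in>S. 0 \<le> w k" "sum w S = 1"
    and Sv: "\<forall>j\<in>{1..m}. (\<Sum>k\<in>S. w k * v j k) = (\<Sum>k<N. 1 / real N * v j k)"
    using caratheodory_finite[of "{..<N}" "\<lambda>_. 1 / real N" m v] N by auto
  have S_fin: "finite S" "S \<noteq> {}" using S finite_subset by auto
  \<comment> \<open>Any order of the ramps will do, so the trivial relation serves; the purpose is a
    list of exactly \<open>m + 1\<close> terms whatever the size of \<open>S\<close>.\<close>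
  obtain \<kappa> \<omega> where \<kappa>: "\<forall>j\<in>{1..m + 1}. \<kappa> j \<in> S \<and> 0 \<le> \<omega> j"
    and sum_eq: "\<forall>F :: nat \<Rightarrow> real. (\<Sum>j = 1..m + 1. \<omega> j * F (\<kappa> j)) = (\<Sum>k\<in>S. w k * F k)"
    using enumerate_total_preorder[of S m w "\<lambda>_ _. True", OF S_fin S(2)] S(3) by auto
  have \<omega>_sum: "(\<Sum>j = 1..m + 1. \<omega> j) = 1" using sum_eq[rule_format, of "\<lambda>_. 1"] S(4) by simp
  have \<omega>01: "\<omega> j \<in> {0..1}" if "j \<in> {1..m + 1}" for j
    using \<kappa> that member_le_sum[of j "{1..m + 1}" \<omega>] \<omega>_sum by auto
  have \<kappa>_less: "\<kappa> j < N" if "j \<in> {1..m + 1}" for j using \<kappa> S(1) that by blast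
  define g where "g y = (\<Sum>j = 1..m + 1. \<omega> j * ramp N (\<kappa> j) y)" for y
  have g_meas [measurable]: "(\<lambda>x. g (f x)) \<in> borel_measurable cube_measure"
    unfolding g_def ramp_def by measurable
  have g0: "g 0 = 0" by (simp add: g_def ramp_0)
  have g1: "g 1 = 1"
  proof -
    have "g 1 = (\<Sum>j = 1..m + 1. \<omega> j)" unfolding g_def by (intro sum.cong refl) (simp add: ramp_1 \<kappa>_less)
    then show ?thesis by (simp only: \<omega>_sum)
  qed
  have g_mono: "g y \<le> g y'" if "y \<le> y'" for y y'
    unfolding g_def using \<kappa> by (intro sum_mono mult_left_mono ramp_mono that) auto
  have g_lip: "g y' - g y \<le> real N * (y' - y)" if "y \<le> y'" for y y'
  proof -
    have "g y' - g y = (\<Sum>j = 1..m + 1. \<omega> j * (ramp N (\<kappa> j) y' - ramp N (\<kappa> j) y))"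
      by (simp only: g_def sum_subtractf[symmetric] right_diff_distrib)
    also have "\<dots> \<le> (\<Sum>j = 1..m + 1. \<omega> j * (real N * (y' - y)))"
      using \<kappa> by (intro sum_mono mult_left_mono ramp_lipschitz that) auto
    also have "\<dots> = real N * (y' - y)" by (simp only: sum_distrib_right[symmetric] \<omega>_sum)
    finally show ?thesis .
  qed
  have g_moment: "moment \<psi> j (\<lambda>x. g (f x)) = moment \<psi> j f" if j: "j \<in> {1..m}" for j
  proof -
    have "moment \<psi> j (\<lambda>x. g (f x)) = (\<Sum>j' = 1..m + 1. \<omega> j' * v j (\<kappa> j'))"
      unfolding g_def v_def by (rule moment_sum[OF \<psi> j ramp_bm])
    also have "\<dots> = (\<Sum>k<N. 1 / real N * v j k)" using sum_eq Sv j by simp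
    also have "\<dots> = moment \<psi> j (\<lambda>x. \<Sum>k<N. 1 / real N * ramp N k (f x))"
      unfolding v_def by (rule moment_sum[OF \<psi> j ramp_bm, symmetric])
    also have "\<dots> = moment \<psi> j f"
      using N f01 sum_ramp[of "f _" N]
      by (intro moment_cong[OF \<psi>]) (simp_all add: sum_divide_distrib[symmetric])
    finally show ?thesis .
  qed
  have "rationalizes (\<lambda>x. g (f x)) q"
  proof (rule extreme_point_replacement[OF \<psi> ext f g_meas _ g_moment])
    show "g (f x) \<in> {0..1}" if "x \<in> unit_cube" for x
      using g_mono[of 0 "f x"] g_mono[of "f x" 1] g0 g1 f01[OF that] by simp
    \<comment> \<open>The step is the reciprocal of the Lipschitz constant of \<open>g\<close>.
      Moving towards \<open>g\<close> leaves slope at least 1 - 1/N, and moving away from it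
      subtracts at most slope 1 from 1 + 1/N.\<close>
    show "0 < 1 / real N" using N by simp
    show "admissible (\<lambda>x. f x + 1 / real N * (g (f x) - f x))"
    proof (rule admissible_compose[OF f(1), of "\<lambda>y. y + 1 / real N * (g y - y)"])
      fix y y' :: real assume "y \<le> y'"
      have "(1 - 1 / real N) * y \<le> (1 - 1 / real N) * y'"
        using \<open>y \<le> y'\<close> N by (intro mult_left_mono) auto
      moreover have "1 / real N * g y \<le> 1 / real N * g y'"
        using g_mono[OF \<open>y \<le> y'\<close>] by (intro mult_left_mono) auto
      ultimately show "y + 1 / real N * (g y - y) \<le> y' + 1 / real N * (g y' - y')"
        unfolding right_diff_distrib left_diff_distrib by linarith
    qed (use g0 g1 in simp_all)
    show "admissible (\<lambda>x. f x - 1 / real N * (g (f x) - f x))"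
    proof (rule admissible_compose[OF f(1), of "\<lambda>y. y - 1 / real N * (g y - y)"])
      fix y y' :: real assume "y \<le> y'"
      have "1 / real N * (g y' - g y) \<le> 1 / real N * (real N * (y' - y))"
        using g_lip[OF \<open>y \<le> y'\<close>] by (intro mult_left_mono) auto
      also have "\<dots> = y' - y" using N by simp
      finally have "1 / real N * g y' - 1 / real N * g y \<le> y' - y" by (simp only: right_diff_distrib)
      moreover have "1 / real N * y \<le> 1 / real N * y'"
        using \<open>y \<le> y'\<close> by (intro mult_left_mono) auto
      ultimately show "y - 1 / real N * (g y - y) \<le> y' - 1 / real N * (g y' - y')"
        unfolding right_diff_distrib by linarith
    qed (use g0 g1 in simp_all)
  qed
  then have "rationalizes (\<lambda>x. \<Sum>j = 1..m + 1. \<omega> j * ramp N (\<kappa> j) (f x)) q"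
    by (simp only: g_def)
  moreover have "\<forall>j\<in>{1..m + 1}. \<kappa> j < N \<and> \<omega> j \<in> {0..1}"
    using \<kappa>_less \<omega>01 by (intro ballI conjI)
  ultimately show ?thesis using \<omega>_sum by (intro exI conjI)
qed

text \<open>The number of terms stays \<open>m + 1\<close> while the ramps steepen, so weights and
  thresholds k/N range over a fixed finite-dimensional cube and converge along a subsequence. Each
  ramp then turns into a jump at \<open>s j\<close>, whose value at the jump itself is recorded by
  \<open>c j\<close>.\<close>

lemma level_set_rationalization:
  assumes f: "admissible f" "rationalizes f q"
  shows "\<exists>s \<omega> c. (\<forall>j\<in>{1..m + 1}. \<omega> j \<in> {0..1} \<and> c j \<in> {0..1}) \<and> (\<Sum>j = 1..m + 1. \<omega> j) = 1 \<and>
    rationalizes (\<lambda>x. \<Sum>j = 1..m + 1. \<omega> j * (if s j < f x then 1 else if f x = s j then c j else 0)) q"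
proof -
  have "\<exists>\<kappa> \<omega>. (\<forall>j\<in>{1..m + 1}. \<kappa> j < Suc n \<and> \<omega> j \<in> {0..1}) \<and> (\<Sum>j = 1..m + 1. \<omega> j) = 1 \<and>
      rationalizes (\<lambda>x. \<Sum>j = 1..m + 1. \<omega> j * ramp (Suc n) (\<kappa> j) (f x)) q" for n
    by (rule ramp_rationalization[OF f]) simp
  then have "\<forall>n. \<exists>\<kappa> \<omega>. (\<forall>j\<in>{1..m + 1}. \<kappa> j < Suc n \<and> \<omega> j \<in> {0..1}) \<and> (\<Sum>j = 1..m + 1. \<omega> j) = 1 \<and>
      rationalizes (\<lambda>x. \<Sum>j = 1..m + 1. \<omega> j * ramp (Suc n) (\<kappa> j) (f x)) q" ..
  from choice[OF this] obtain \<kappa> where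
    "\<forall>n. \<exists>\<omega>. (\<forall>j\<in>{1..m + 1}. \<kappa> n j < Suc n \<and> \<omega> j \<in> {0..1}) \<and> (\<Sum>j = 1..m + 1. \<omega> j) = 1 \<and>
      rationalizes (\<lambda>x. \<Sum>j = 1..m + 1. \<omega> j * ramp (Suc n) (\<kappa> n j) (f x)) q" ..
  from choice[OF this] obtain \<Omega> where
    *: "\<forall>n. (\<forall>j\<in>{1..m + 1}. \<kappa> n j < Suc n \<and> \<Omega> n j \<in> {0..1}) \<and> (\<Sum>j = 1..m + 1. \<Omega> n j) = 1 \<and>
      rationalizes (\<lambda>x. \<Sum>j = 1..m + 1. \<Omega> n j * ramp (Suc n) (\<kappa> n j) (f x)) q" ..
  have \<kappa>: "\<kappa> n j < Suc n" and \<Omega>: "\<Omega> n j \<in> {0..1}" if "j \<in> {1..m + 1}" for n j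
    using * that by blast+
  have rat: "rationalizes (\<lambda>x. \<Sum>j = 1..m + 1. \<Omega> n j * ramp (Suc n) (\<kappa> n j) (f x)) q" for n
    using * by blast
  have "\<exists>r l. strict_mono r \<and> (\<forall>j\<in>{1..m + 1}. l j \<in> {0..1} \<and> (\<lambda>n. \<Omega> (r n) j) \<longlonglongrightarrow> l j)"
    by (rule common_convergent_subseq) (use \<Omega> in auto)
  then obtain r1 \<omega> where r1: "strict_mono r1"
    and \<omega>: "\<And>j. j \<in> {1..m + 1} \<Longrightarrow> \<omega> j \<in> {0..1}" "\<And>j. j \<in> {1..m + 1} \<Longrightarrow> (\<lambda>n. \<Omega> (r1 n) j) \<longlonglongrightarrow> \<omega> j"
    by blast
  have "\<exists>r l. strict_mono r \<and> (\<forall>j\<in>{1..m + 1}. l j \<in> {0..1} \<and>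
      (\<lambda>n. real (\<kappa> (r1 (r n)) j) / real (Suc (r1 (r n)))) \<longlonglongrightarrow> l j)"
    by (rule common_convergent_subseq[of _ "\<lambda>j n. real (\<kappa> (r1 n) j) / real (Suc (r1 n))"])
       (use \<kappa> in \<open>auto simp: less_imp_le field_simps simp del: of_nat_Suc\<close>)
  then obtain r2 s where r2: "strict_mono r2"
    and s: "\<And>j. j \<in> {1..m + 1} \<Longrightarrow> (\<lambda>n. real (\<kappa> (r1 (r2 n)) j) / real (Suc (r1 (r2 n)))) \<longlonglongrightarrow> s j"
    by blast
  define R where "R n = r1 (r2 n)" for n
  \<comment> \<open>A third extraction, for the values of the ramps at the limiting thresholds
    themselves, where the ramp limits leave the value open. It matters because {f = s j} may have
    positive measure.\<close>
  have "\<exists>r l. strict_mono r \<and> (\<forall>j\<in>{1..m + 1}. l j \<in> {0..1} \<and>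
      (\<lambda>n. ramp (Suc (R (r n))) (\<kappa> (R (r n)) j) (s j)) \<longlonglongrightarrow> l j)"
    by (rule common_convergent_subseq[of _ "\<lambda>j n. ramp (Suc (R n)) (\<kappa> (R n) j) (s j)"])
       (auto simp: ramp_range)
  then obtain r3 c where r3: "strict_mono r3" and c: "\<And>j. j \<in> {1..m + 1} \<Longrightarrow> c j \<in> {0..1}"
    "\<And>j. j \<in> {1..m + 1} \<Longrightarrow> (\<lambda>n. ramp (Suc (R (r3 n))) (\<kappa> (R (r3 n)) j) (s j)) \<longlonglongrightarrow> c j"
    by blast
  define r where "r n = R (r3 n)" for n
  have "strict_mono r"
    using r1 r2 r3 by (simp add: strict_mono_def r_def R_def)
  then have "filterlim (\<lambda>n. Suc (r n)) at_top sequentially"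
    using filterlim_compose[OF filterlim_Suc filterlim_subseq] by blast
  note ramp_lim = ramp_limit[OF this]
  have "(\<lambda>n. \<Sum>j = 1..m + 1. \<Omega> (r n) j * ramp (Suc (r n)) (\<kappa> (r n) j) y)
      \<longlonglongrightarrow> (\<Sum>j = 1..m + 1. \<omega> j * (if s j < y then 1 else if y = s j then c j else 0))" for y
  proof (intro tendsto_sum tendsto_mult)
    fix j assume j: "j \<in> {1..m + 1}"
    show "(\<lambda>n. \<Omega> (r n) j) \<longlonglongrightarrow> \<omega> j"
      using LIMSEQ_subseq_LIMSEQ[OF \<omega>(2)[OF j] strict_mono_o[OF r2 r3]] by (simp add: o_def r_def R_def)
    have "(\<lambda>n. real (\<kappa> (r n) j) / real (Suc (r n))) \<longlonglongrightarrow> s j"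
      using LIMSEQ_subseq_LIMSEQ[OF s[OF j] r3] by (simp add: o_def r_def R_def)
    from ramp_lim[OF this, of y]
    show "(\<lambda>n. ramp (Suc (r n)) (\<kappa> (r n) j) y) \<longlonglongrightarrow> (if s j < y then 1 else if y = s j then c j else 0)"
      using c(2)[OF j] by (cases y "s j" rule: linorder_cases) (auto simp: r_def)
  qed
  from rationalizes_limit[OF rat this]
  have "rationalizes (\<lambda>x. \<Sum>j = 1..m + 1. \<omega> j * (if s j < f x then 1 else if f x = s j then c j else 0)) q"
    .
  moreover have "(\<Sum>j = 1..m + 1. \<omega> j) = 1"
  proof (rule LIMSEQ_unique)
    show "(\<lambda>n. \<Sum>j = 1..m + 1. \<Omega> (r1 n) j) \<longlonglongrightarrow> (\<Sum>j = 1..m + 1. \<omega> j)"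
      by (intro tendsto_sum \<omega>(2))
    show "(\<lambda>n. \<Sum>j = 1..m + 1. \<Omega> (r1 n) j) \<longlonglongrightarrow> 1" using * by simp
  qed
  moreover have "\<forall>j\<in>{1..m + 1}. \<omega> j \<in> {0..1} \<and> c j \<in> {0..1}" using \<omega>(1) c(1) by (intro ballI conjI)
  ultimately show ?thesis by (intro exI conjI)
qed

text \<open>Here the perturbation acts on the weights instead of the values of \<open>f\<close>:
  since all \<open>w k\<close> are positive, a small move of the weight vector in either direction
  stays nonnegative and sums to 1. Both results are again mixtures of up-sets, hence
  admissible.\<close>

lemma chain_mixture_reduction:
  fixes U :: "'k \<Rightarrow> ('n \<Rightarrow> real) set"
  assumes K: "finite K" and w: "\<And>k. k \<in> K \<Longrightarrow> 0 < w k" "sum w K = 1"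
    and U: "\<And>k. k \<in> K \<Longrightarrow> U k \<in> sets cube_measure" "\<And>k. k \<in> K \<Longrightarrow> up_set (U k)"
    and chain: "\<And>k k'. k \<in> K \<Longrightarrow> k' \<in> K \<Longrightarrow> U k \<subseteq> U k' \<or> U k' \<subseteq> U k"
    and rat: "rationalizes (\<lambda>x. \<Sum>k\<in>K. w k * indicator (U k) x) q"
  shows "\<exists>A \<omega>. (\<forall>j\<in>{1..m + 1}. up_set (A j)) \<and>
    (\<forall>j\<in>{1..m + 1}. \<forall>j'\<in>{1..m + 1}. j < j' \<longrightarrow> A j \<subseteq> A j') \<and>
    (\<forall>j\<in>{1..m + 1}. 0 \<le> \<omega> j) \<and> (\<Sum>j = 1..m + 1. \<omega> j) = 1 \<and>
    rationalizes (\<lambda>x. \<Sum>j = 1..m + 1. \<omega> j * indicator (A j) x) q"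
proof -
  define v where "v j k = moment \<psi> j (indicator (U k))" for j k
  have bm: "bounded_measurable (indicator (U k))" if "k \<in> K" for k
    using U(1)[OF that] by (intro bounded_measurableI[where C = 1]) (auto simp: indicator_def)
  have "\<exists>S w'. S \<subseteq> K \<and> card S \<le> m + 1 \<and> (\<forall>k\<in>S. 0 \<le> w' k) \<and> sum w' S = 1 \<and>
      (\<forall>j\<in>{1..m}. (\<Sum>k\<in>S. w' k * v j k) = (\<Sum>k\<in>K. w k * v j k))"
    by (rule caratheodory_finite[OF K less_imp_le[OF w(1)] w(2)])
  then obtain S w' where S: "S \<subseteq> K" "card S \<le> m + 1" "\<forall>k\<in>S. 0 \<le> w' k" "sum w' S = 1"
    and Sv: "\<forall>j\<in>{1..m}. (\<Sum>k\<in>S. w' k * v j k) = (\<Sum>k\<in>K. w k * v j k)"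
    by (elim exE conjE)
  have S_fin: "finite S" "S \<noteq> {}" using S finite_subset[OF S(1) K] by auto
  have K_ne: "K \<noteq> {}" using S_fin(2) S(1) by auto
  \<comment> \<open>The new weights extended by 0 to all of \<open>K\<close>, so that old and new
    mixture are sums over the same index set.\<close>
  define u where "u k = (if k \<in> S then w' k else 0)" for k
  have u_sum: "(\<Sum>k\<in>K. u k * F k) = (\<Sum>k\<in>S. w' k * F k)" for F :: "'k \<Rightarrow> real"
    unfolding u_def using K S(1) by (intro sum.mono_neutral_cong_right) auto
  have u01: "0 \<le> u k" "u k \<le> 1" for k
    unfolding u_def using S(3,4) member_le_sum[of k S w'] S_fin(1) by auto
  have u1: "sum u K = 1" using u_sum[of "\<lambda>_. 1"] S(4) by simp
  \<comment> \<open>The bound by 1 makes the move towards \<open>u\<close> a convex combination of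
    weights. The bound by \<open>w k\<close>, together with \<open>u k \<le> 1\<close>, keeps
    \<open>w k - \<epsilon> * (u k - w k)\<close> nonnegative.\<close>
  define \<epsilon> where "\<epsilon> = Min (insert 1 (w ` K))"
  have \<epsilon>: "0 < \<epsilon>" "\<epsilon> \<le> 1" "\<And>k. k \<in> K \<Longrightarrow> \<epsilon> \<le> w k"
    unfolding \<epsilon>_def using K w(1) by auto
  define f where "f x = (\<Sum>k\<in>K. w k * indicator (U k) x)" for x
  define g where "g x = (\<Sum>k\<in>K. u k * indicator (U k) x)" for x
  have combine: "f x + c * (g x - f x) = (\<Sum>k\<in>K. (w k + c * (u k - w k)) * indicator (U k) x)" for x c
    unfolding f_def g_def
    by (simp add: sum_subtractf[symmetric] sum_distrib_left sum.distrib[symmetric] algebra_simps)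
  have adm: "admissible (\<lambda>x. f x + c * (g x - f x))" if c: "\<And>k. k \<in> K \<Longrightarrow> 0 \<le> w k + c * (u k - w k)" for c
    unfolding combine
  proof (rule admissible_mixture[OF K c _ U])
    have "(\<Sum>k\<in>K. w k + c * (u k - w k)) = sum w K + c * (sum u K - sum w K)"
      by (simp add: sum.distrib sum_distrib_left[symmetric] sum_subtractf)
    then show "(\<Sum>k\<in>K. w k + c * (u k - w k)) = 1" using w(2) u1 by simp
  qed
  have g_adm: "admissible g"
    using adm[of 1] u01 by simp
  have "rationalizes g q"
  proof (rule extreme_point_replacement[OF \<psi> ext])
    show "admissible f" using adm[of 0] w(1) by (simp add: less_imp_le)
    show "rationalizes f q" using rat by (simp add: f_def[abs_def])
    show "g \<in> borel_measurable cube_measure" "\<And>x. x \<in> unit_cube \<Longrightarrow> g x \<in> {0..1}"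
      using g_adm by (simp_all add: admissible_def)
    show "moment \<psi> j g = moment \<psi> j f" if "j \<in> {1..m}" for j
    proof -
      have "moment \<psi> j g = (\<Sum>k\<in>K. u k * v j k)" "moment \<psi> j f = (\<Sum>k\<in>K. w k * v j k)"
        unfolding g_def f_def v_def by (rule moment_sum[OF \<psi> that bm], assumption+)+
      then show ?thesis using u_sum Sv that by simp
    qed
    show "0 < \<epsilon>" by (rule \<epsilon>)
    show "admissible (\<lambda>x. f x + \<epsilon> * (g x - f x))"
    proof (rule adm)
      fix k assume "k \<in> K"
      then have "0 \<le> (1 - \<epsilon>) * w k + \<epsilon> * u k"
        using \<epsilon> w(1) u01 by (intro add_nonneg_nonneg mult_nonneg_nonneg) (auto simp: less_imp_le)
      then show "0 \<le> w k + \<epsilon> * (u k - w k)" by (simp add: algebra_simps)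
    qed
    have "admissible (\<lambda>x. f x + (- \<epsilon>) * (g x - f x))"
    proof (rule adm)
      fix k assume k: "k \<in> K"
      have "\<epsilon> * u k \<le> \<epsilon> * 1" using \<epsilon>(1) u01 by (intro mult_left_mono) auto
      moreover have "0 \<le> \<epsilon> * w k" using \<epsilon>(1) w(1)[OF k] by simp
      ultimately show "0 \<le> w k + (- \<epsilon>) * (u k - w k)" using \<epsilon>(3)[OF k] by (simp add: algebra_simps)
    qed
    then show "admissible (\<lambda>x. f x - \<epsilon> * (g x - f x))" by simp
  qed
  have "\<exists>\<kappa> \<omega>. (\<forall>j\<in>{1..m + 1}. \<kappa> j \<in> S \<and> 0 \<le> \<omega> j) \<and>
      (\<forall>j\<in>{1..m + 1}. \<forall>j'\<in>{1..m + 1}. j < j' \<longrightarrow> U (\<kappa> j) \<subseteq> U (\<kappa> j')) \<and>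
      (\<forall>F :: 'k \<Rightarrow> real. (\<Sum>j = 1..m + 1. \<omega> j * F (\<kappa> j)) = (\<Sum>k\<in>S. w' k * F k))"
  proof (rule enumerate_total_preorder[OF S_fin S(2)])
    show "0 \<le> w' k" if "k \<in> S" for k using S(3) that by blast
    show "U k \<subseteq> U k' \<or> U k' \<subseteq> U k" if "k \<in> S" "k' \<in> S" for k k'
      using chain S(1) that by blast
  qed (rule subset_trans)
  then obtain \<kappa> \<omega> where \<kappa>: "\<forall>j\<in>{1..m + 1}. \<kappa> j \<in> S \<and> 0 \<le> \<omega> j"
    and nested: "\<forall>j\<in>{1..m + 1}. \<forall>j'\<in>{1..m + 1}. j < j' \<longrightarrow> U (\<kappa> j) \<subseteq> U (\<kappa> j')"
    and sum_eq: "\<forall>F :: 'k \<Rightarrow> real. (\<Sum>j = 1..m + 1. \<omega> j * F (\<kappa> j)) = (\<Sum>k\<in>S. w' k * F k)"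
    by (elim exE conjE)
  have "(\<Sum>j = 1..m + 1. \<omega> j * indicator (U (\<kappa> j)) x) = g x" for x
    unfolding g_def u_sum by (rule sum_eq[rule_format])
  then have "rationalizes (\<lambda>x. \<Sum>j = 1..m + 1. \<omega> j * indicator (U (\<kappa> j)) x) q"
    using \<open>rationalizes g q\<close> by simp
  moreover have "(\<Sum>j = 1..m + 1. \<omega> j) = 1"
    using sum_eq[rule_format, of "\<lambda>_. 1"] S(4) by simp
  moreover have "up_set (U (\<kappa> j))" if "j \<in> {1..m + 1}" for j
    using \<kappa> that S(1) by (intro U(2)) blast
  ultimately show ?thesis
    using \<kappa> nested by (intro exI[of _ "\<lambda>j. U (\<kappa> j)"] exI[of _ \<omega>] conjI) blast+
qed

text \<open>A jump at \<open>s\<close> with value \<open>c\<close> on {f = s} equals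
  \<open>c\<close> times the indicator of {f \<ge> s} plus \<open>1 - c\<close> times that of {f >
  s}. All these sets are level sets of one monotone function, hence up-sets forming a chain, and the
  reduction cuts their number from at most 2(m + 1) to \<open>m + 1\<close>.\<close>

lemma extreme_point_nested_mixture:
  "\<exists>A \<omega>. (\<forall>j\<in>{1..m + 1}. up_set (A j)) \<and>
    (\<forall>j\<in>{1..m + 1}. \<forall>j'\<in>{1..m + 1}. j < j' \<longrightarrow> A j \<subseteq> A j') \<and>
    (\<forall>j\<in>{1..m + 1}. 0 \<le> \<omega> j) \<and> (\<Sum>j = 1..m + 1. \<omega> j) = 1 \<and>
    rationalizes (\<lambda>x. \<Sum>j = 1..m + 1. \<omega> j * indicator (A j) x) q"
proof -
  have "q \<in> rationalizable_tuples"
    using ext by (simp add: ae_extreme_point_of_def constrained_tuples_def)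
  then obtain f where f: "admissible f" "rationalizes f q"
    using monotone_rationalization by blast
  have f_meas [measurable]: "f \<in> borel_measurable cube_measure" using f(1) by (simp add: admissible_def)
  obtain s \<omega> c where c: "\<forall>j\<in>{1..m + 1}. \<omega> j \<in> {0..1} \<and> c j \<in> {0..1}"
    and sum1: "(\<Sum>j = 1..m + 1. \<omega> j) = 1"
    and rat: "rationalizes (\<lambda>x. \<Sum>j = 1..m + 1. \<omega> j * (if s j < f x then 1 else if f x = s j then c j else 0)) q"
    using level_set_rationalization[OF f] by (elim exE conjE)
  \<comment> \<open>The Boolean distinguishes the closed level set, with share \<open>c j\<close>,
    from the open one, with share \<open>1 - c j\<close>.\<close>
  define U where "U = (\<lambda>(j, b). if b then {x \<in> unit_cube. s j \<le> f x} else {x \<in> unit_cube. s j < f x})"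
  define w where "w = (\<lambda>(j, b). \<omega> j * (if b then c j else 1 - c j))"
  \<comment> \<open>Pairs of weight 0 are discarded because the reduction perturbs every weight
    downwards and so needs strict positivity.\<close>
  define K where "K = {k \<in> {1..m + 1} \<times> (UNIV :: bool set). w k > 0}"
  have w0: "0 \<le> w k" if "k \<in> {1..m + 1} \<times> UNIV" for k
    using c that by (auto simp: w_def)
  have K_sum: "(\<Sum>k\<in>K. w k * F k) = (\<Sum>j = 1..m + 1. \<omega> j * (c j * F (j, True) + (1 - c j) * F (j, False)))" for F
  proof -
    have "(\<Sum>k\<in>K. w k * F k) = (\<Sum>k\<in>{1..m + 1} \<times> UNIV. w k * F k)"
    proof (intro sum.mono_neutral_left ballI)
      fix k assume "k \<in> {1..m + 1} \<times> UNIV - K"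
      then have "w k = 0" using w0[of k] unfolding K_def by force
      then show "w k * F k = 0" by simp
    qed (auto simp: K_def)
    also have "\<dots> = (\<Sum>j = 1..m + 1. \<Sum>b\<in>UNIV. w (j, b) * F (j, b))"
      by (simp add: sum.cartesian_product)
    also have "\<dots> = (\<Sum>j = 1..m + 1. \<omega> j * (c j * F (j, True) + (1 - c j) * F (j, False)))"
      by (intro sum.cong) (auto simp: UNIV_bool w_def algebra_simps)
    finally show ?thesis .
  qed
  show ?thesis
  proof (rule chain_mixture_reduction)
    show "finite K" unfolding K_def
      by (rule finite_subset[OF Collect_restrict]) (intro finite_cartesian_product finite_atLeastAtMost finite)
    show "0 < w k" if "k \<in> K" for k using that by (simp add: K_def)
    show "sum w K = 1" using K_sum[of "\<lambda>_. 1"] sum1 by simp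
    show "U k \<in> sets cube_measure" for k
    proof -
      have "{x \<in> space cube_measure. s j \<le> f x} \<in> sets cube_measure"
        "{x \<in> space cube_measure. s j < f x} \<in> sets cube_measure" for j
        by measurable
      then show ?thesis by (auto simp: U_def space_cube_measure split: prod.split)
    qed
    show "up_set (U k)" for k
    proof -
      have "mono_on unit_cube f" using f(1) by (simp add: admissible_def)
      then have "f x \<le> f y" if "x \<in> unit_cube" "y \<in> unit_cube" "x \<le> y" for x y
        using that by (rule mono_onD)
      then show ?thesis
        by (cases k) (fastforce simp: U_def up_set_def)
    qed
    show "U k \<subseteq> U k' \<or> U k' \<subseteq> U k" for k k'
    proof (cases k; cases k')
      fix j b j' b' assume "k = (j, b)" "k' = (j', b')"
      then show ?thesis
        by (cases "s j" "s j'" rule: linorder_cases) (auto simp: U_def)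
    qed
    have eq: "(\<Sum>k\<in>K. w k * indicator (U k) x)
        = (\<Sum>j = 1..m + 1. \<omega> j * (if s j < f x then 1 else if f x = s j then c j else 0))"
      if "x \<in> unit_cube" for x
      unfolding K_sum using that by (intro sum.cong) (auto simp: U_def indicator_def)
    \<comment> \<open>The two functions are compared only on the cube, as \<open>U\<close> contains
      no other points; the limit lemma with a constant sequence transfers the
      rationalization.\<close>
    show "rationalizes (\<lambda>x. \<Sum>k\<in>K. w k * indicator (U k) x) q"
      by (rule rationalizes_limit[OF rat]) (simp only: eq tendsto_const)
  qed
qed

end

theorem theorem2:
  fixes \<psi> :: "'n::finite \<Rightarrow> nat \<Rightarrow> real \<Rightarrow> real" and \<eta> :: "nat \<Rightarrow> real" and m :: nat
  assumes "\<And>i j. j \<in> {1..m} \<Longrightarrow> ess_bounded (\<psi> i j)"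
  shows "(\<forall>q :: 'n \<Rightarrow> real \<Rightarrow> real. q ae_extreme_point_of rationalizable_tuples \<longrightarrow>
            (\<exists>A. up_set A \<and> rationalizes (indicator A) q)) \<and>
         (\<forall>q :: 'n \<Rightarrow> real \<Rightarrow> real. q ae_extreme_point_of constrained_tuples m \<psi> \<eta> \<longrightarrow>
            (\<exists>(A :: nat \<Rightarrow> ('n \<Rightarrow> real) set) (w :: nat \<Rightarrow> real).
               (\<forall>j\<in>{1..m + 1}. up_set (A j)) \<and>
               (\<forall>j\<in>{1..m + 1}. \<forall>j'\<in>{1..m + 1}. j < j' \<longrightarrow> A j \<subseteq> A j') \<and>
               (\<forall>j\<in>{1..m + 1}. 0 \<le> w j) \<and> (\<Sum>j = 1..m + 1. w j) = 1 \<and>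
               rationalizes (\<lambda>x. \<Sum>j = 1..m + 1. w j * indicator (A j) x) q))"
proof (intro conjI allI impI)
  fix q :: "'n \<Rightarrow> real \<Rightarrow> real" assume "q ae_extreme_point_of rationalizable_tuples"
  then have extreme: "q ae_extreme_point_of constrained_tuples 0 \<psi> \<eta>" by (simp add: constrained_tuples_def)
  have "\<exists>(A :: nat \<Rightarrow> ('n \<Rightarrow> real) set) w. (\<forall>j\<in>{1..0 + 1}. up_set (A j)) \<and>
      (\<forall>j\<in>{1..0 + 1}. \<forall>j'\<in>{1..0 + 1}. j < j' \<longrightarrow> A j \<subseteq> A j') \<and>
      (\<forall>j\<in>{1..0 + 1}. 0 \<le> w j) \<and> (\<Sum>j = 1..0 + 1. w j) = 1 \<and>
      rationalizes (\<lambda>x. \<Sum>j = 1..0 + 1. w j * indicator (A j) x) q"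
    by (rule extreme_point_nested_mixture[OF _ extreme]) simp
  then obtain A :: "nat \<Rightarrow> ('n \<Rightarrow> real) set" and w :: "nat \<Rightarrow> real"
    where A: "\<forall>j\<in>{1..0 + 1}. up_set (A j)" "(\<Sum>j = 1..0 + 1. w j) = 1"
      "rationalizes (\<lambda>x. \<Sum>j = 1..0 + 1. w j * indicator (A j) x) q"
    by (elim exE conjE)
  have singleton: "{1..0 + 1} = {1::nat}" by simp
  have "up_set (A 1)" "w 1 = 1" using A(1,2) unfolding singleton by simp_all
  moreover from this have "(\<lambda>x. \<Sum>j = 1..0 + 1. w j * indicator (A j) x) = indicator (A 1)"
    unfolding singleton by (intro ext) simp
  ultimately show "\<exists>A. up_set A \<and> rationalizes (indicator A) q" using A(3) by auto
next
  fix q :: "'n \<Rightarrow> real \<Rightarrow> real" assume "q ae_extreme_point_of constrained_tuples m \<psi> \<eta>"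
  from extreme_point_nested_mixture[OF assms this]
  show "\<exists>(A :: nat \<Rightarrow> ('n \<Rightarrow> real) set) (w :: nat \<Rightarrow> real).
      (\<forall>j\<in>{1..m + 1}. up_set (A j)) \<and>
      (\<forall>j\<in>{1..m + 1}. \<forall>j'\<in>{1..m + 1}. j < j' \<longrightarrow> A j \<subseteq> A j') \<and>
      (\<forall>j\<in>{1..m + 1}. 0 \<le> w j) \<and> (\<Sum>j = 1..m + 1. w j) = 1 \<and>
      rationalizes (\<lambda>x. \<Sum>j = 1..m + 1. w j * indicator (A j) x) q" .
qed

end
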